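(* Let $\varphi\in \mathcal{A}=L^2(\mathbb{R}^d)\cap L^\infty(\mathbb{R}^d)$ with $\|\varphi\|_\infty\le1$, let $T_1$ be a homomorphism of $\mathcal{A}$, and let $T=\mathcal{M}_\varphi T_1$, i.e. $Tf=\varphi\cdot T_1f$ for $f\in\mathcal{A}$. If $T$ is a contraction for $L^2(\mathbb{R}^d)$ and for $L^\infty(\mathbb{R}^d)$, i.e. $\|Tf\|_2\le\|f\|_2$ and $\|Tf\|_\infty\le\|f\|_\infty$ for all $f\in\mathcal{A}$, then $\Gamma_2(T)$ is a contraction.
   Context: Fix $d\ge1$ and a constant $c>0$. $\mathcal{A}=L^2(\mathbb{R}^d)\cap L^\infty(\mathbb{R}^d)$ denotes the complex-valued functions (modulo a.e. equality) with pointwise multiplication, complex conjugation, and $\langle f,g\rangle=\int_{\mathbb{R}^d}\bar f(s)g(s)\,ds$. A homomorphism of $\mathcal{A}$ is a linear map $T_1:\mathcal{A}\to\mathcal{A}$ with $T_1(fg)=T_1(f)T_1(g)$; $\mathcal{M}_\varphi$ is multiplication by $\varphi$. The RSWN algebra is the $*$-Lie algebra with central element $1$ and generators $B^+_f,B_f,N_f$ ($f\in\mathcal{A}$), with $f\mapsto B_f^+$ and $f\mapsto N_f$ complex linear, involution $(B_f^+)^*=B_f$, $N_f^*=N_{\bar f}$, and commutation relations $[B_f,B^+_g]=2c\langle f,g\rangle 1+4N_{\bar f g}$, $[N_a,B_f^+]=2B^+_{af}$, $[B^+_f,B^+_g]=[B_f,B_g]=[N_a,N_{a'}]=0$. On its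 universal enveloping algebra there is a unique state $\varphi_F$ with $\varphi_F(1)=1$ and $\varphi_F(xB_g)=\varphi_F(xN_f)=0$ for all $f,g\in\mathcal{A}$ and all $x$ (a known fact). The quadratic Fock space $\Gamma_2(\mathcal{A})$ is the (complete) GNS Hilbert space of $\varphi_F$, with cyclic unit vector $\Phi$ satisfying $B_f\Phi=N_f\Phi=0$ for all $f\in\mathcal{A}$. For $f\in\mathcal{A}$ the quadratic exponential vector is $\Psi(f)=\sum_{n\ge0}\frac{1}{n!}B^{+n}_f\Phi$ when the series converges. Known facts: $\Psi(f)$ exists if $\|f\|_\infty<\frac12$ and does not exist if $\|f\|_\infty>\frac12$; the set of these vectors is linearly independent and total in $\Gamma_2(\mathcal{A})$; and $\langle\Psi(f),\Psi(g)\rangle=\exp\big(-\frac c2\int_{\mathbb{R}^d}\ln(1-4\bar f(s)g(s))\,ds\big)$ for $\|f\|_\infty,\|g\|_\infty<\frac12$. For a linear operator $T$ on $\mathcal{A}$, if $\Psi(f)\mapsto\Psi(Tf)$ is well defined on all quadratic exponential vectors with $\|f\|_\infty<\frac12$, its linear extension to their (dense) linear span is denoted $\Gamma_2(T)$, the quadratic second quantization of $T$. Saying that $\Gamma_2(T)$ is a contraction means that it is well defined and extends to an operator of norm at most $1$ on $\Gamma_2(\mathcal{A})$. *)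

theory Defs
  imports
    "HOL-Analysis.Analysis"
    "HOL-Library.Poly_Mapping"
    "HOL-Probability.Essential_Supremum"
begin

section \<open>Complex vector spaces and complex Hilbert spaces\<close>

class complex_vector = ab_group_add +
  fixes scaleC :: "complex \<Rightarrow> 'a \<Rightarrow> 'a"  (infixr \<open>*\<^sub>C\<close> 75)
  assumes scaleC_add_right: "a *\<^sub>C (x + y) = a *\<^sub>C x + a *\<^sub>C y"
    and scaleC_add_left: "(a + b) *\<^sub>C x = a *\<^sub>C x + b *\<^sub>C x"
    and scaleC_scaleC: "a *\<^sub>C (b *\<^sub>C x) = (a * b) *\<^sub>C x"
    and scaleC_one: "1 *\<^sub>C x = x"

text \<open>Inner products are antilinear in the first argument. Completeness comes from \<open>banach\<close>.\<close>

class complex_hilbert = banach + complex_vector +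
  fixes cinner :: "'a \<Rightarrow> 'a \<Rightarrow> complex"
  assumes scaleR_scaleC: "r *\<^sub>R x = complex_of_real r *\<^sub>C x"
    and cinner_add_right: "cinner x (y + z) = cinner x y + cinner x z"
    and cinner_scaleC_right: "cinner x (a *\<^sub>C y) = a * cinner x y"
    and cinner_commute: "cinner y x = cnj (cinner x y)"
    and cinner_ge_zero: "cinner x x \<in> \<real>\<^sub>\<ge>\<^sub>0"
    and norm_eq_sqrt_cinner: "norm x = sqrt (Re (cinner x x))"

abbreviation clinear :: "('a::complex_vector \<Rightarrow> 'b::complex_vector) \<Rightarrow> bool"
  where "clinear \<equiv> Vector_Spaces.linear scaleC scaleC"

instantiation complex :: complex_vector
begin

definition scaleC_complex :: "complex \<Rightarrow> complex \<Rightarrow> complex"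
  where "scaleC_complex a x = a * x"

instance
  by standard (simp_all add: scaleC_complex_def algebra_simps)

end


section \<open>The algebra of square-integrable, essentially bounded functions\<close>

definition L2_Linf :: "(real^'d::finite \<Rightarrow> complex) \<Rightarrow> bool"
  where "L2_Linf f \<longleftrightarrow> f \<in> borel_measurable lborel
    \<and> integrable lborel (\<lambda>s. (cmod (f s))\<^sup>2)
    \<and> (\<exists>C. AE s in lborel. cmod (f s) \<le> C)"

definition L2_Linf_eq :: "(real^'d::finite \<Rightarrow> complex) \<Rightarrow> (real^'d \<Rightarrow> complex) \<Rightarrow> bool"
  where "L2_Linf_eq f g \<longleftrightarrow> L2_Linf f \<and> L2_Linf g \<and> (AE s in lborel. f s = g s)"

lemma L2_Linf_zero: "L2_Linf (\<lambda>s. 0)"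
  by (auto simp: L2_Linf_def)

lemma L2_Linf_dominated:
  assumes h: "h \<in> borel_measurable lborel" and f: "L2_Linf f" and g: "L2_Linf g"
    and le: "AE s in lborel. cmod (h s) \<le> K * (cmod (f s) + cmod (g s))"
  shows "L2_Linf h"
proof -
  have int: "integrable lborel (\<lambda>s. K\<^sup>2 * (2 * (cmod (f s))\<^sup>2 + 2 * (cmod (g s))\<^sup>2))"
    using f g by (auto simp: L2_Linf_def)
  have "AE s in lborel. norm ((cmod (h s))\<^sup>2)
      \<le> norm (K\<^sup>2 * (2 * (cmod (f s))\<^sup>2 + 2 * (cmod (g s))\<^sup>2))"
    using le
  proof eventually_elim
    case (elim s)
    have "(cmod (h s))\<^sup>2 \<le> (K * (cmod (f s) + cmod (g s)))\<^sup>2"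
      using elim by (intro power_mono) auto
    also have "\<dots> = K\<^sup>2 * (cmod (f s) + cmod (g s))\<^sup>2"
      by (simp add: power_mult_distrib)
    also have "\<dots> \<le> K\<^sup>2 * (2 * (cmod (f s))\<^sup>2 + 2 * (cmod (g s))\<^sup>2)"
      using sum_squares_bound[of "cmod (f s)" "cmod (g s)"]
      by (intro mult_left_mono) (auto simp: power2_sum)
    finally show ?case by simp
  qed
  then have "integrable lborel (\<lambda>s. (cmod (h s))\<^sup>2)"
    using h by (intro Bochner_Integration.integrable_bound[OF int]) auto
  moreover obtain C D where
    C: "AE s in lborel. cmod (f s) \<le> C" and D: "AE s in lborel. cmod (g s) \<le> D"
    using f g by (auto simp: L2_Linf_def)
  have "AE s in lborel. cmod (h s) \<le> \<bar>K\<bar> * (C + D)"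
    using le C D
  proof eventually_elim
    case (elim s)
    have "K * (cmod (f s) + cmod (g s)) \<le> \<bar>K\<bar> * (cmod (f s) + cmod (g s))"
      by (intro mult_right_mono) auto
    also have "\<dots> \<le> \<bar>K\<bar> * (C + D)"
      using elim by (intro mult_left_mono) auto
    finally show ?case using elim by simp
  qed
  ultimately show ?thesis
    using h unfolding L2_Linf_def by blast
qed

lemma L2_Linf_measurable: "L2_Linf f \<Longrightarrow> f \<in> borel_measurable borel"
  by (simp add: L2_Linf_def)

lemma L2_Linf_add: "L2_Linf f \<Longrightarrow> L2_Linf g \<Longrightarrow> L2_Linf (\<lambda>s. f s + g s)"
  by (rule L2_Linf_dominated[of _ f g 1])
    (auto dest: L2_Linf_measurable intro: borel_measurable_add norm_triangle_ineq)

lemma L2_Linf_scale: "L2_Linf f \<Longrightarrow> L2_Linf (\<lambda>s. a * f s)"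
  by (rule L2_Linf_dominated[of _ f f "cmod a"])
    (auto dest: L2_Linf_measurable intro!: borel_measurable_times mult_left_mono simp: norm_mult)

lemma L2_Linf_minus: "L2_Linf f \<Longrightarrow> L2_Linf (\<lambda>s. - f s)"
  using L2_Linf_scale[of f "-1"] by simp

lemma L2_Linf_diff: "L2_Linf f \<Longrightarrow> L2_Linf g \<Longrightarrow> L2_Linf (\<lambda>s. f s - g s)"
  using L2_Linf_add[OF _ L2_Linf_minus, of f g] by simp

lemma L2_Linf_mult:
  assumes f: "L2_Linf f" and g: "L2_Linf g"
  shows "L2_Linf (\<lambda>s. f s * g s)"
proof -
  obtain C where C: "AE s in lborel. cmod (f s) \<le> C"
    using f by (auto simp: L2_Linf_def)
  show ?thesis
  proof (rule L2_Linf_dominated[OF _ g g])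
    show "(\<lambda>s. f s * g s) \<in> borel_measurable lborel"
      using f g by (auto dest: L2_Linf_measurable intro: borel_measurable_times)
    show "AE s in lborel. cmod (f s * g s) \<le> \<bar>C\<bar> * (cmod (g s) + cmod (g s))"
      using C
    proof eventually_elim
      case (elim s)
      have "cmod (f s) * cmod (g s) \<le> \<bar>C\<bar> * (cmod (g s) + cmod (g s))"
        using elim by (intro mult_mono) auto
      then show ?case by (simp add: norm_mult)
    qed
  qed
qed

lemma L2_Linf_cnj:
  assumes f: "L2_Linf f"
  shows "L2_Linf (\<lambda>s. cnj (f s))"
proof -
  have "(\<lambda>s. cnj (f s)) \<in> borel_measurable lborel"
    using L2_Linf_measurable[OF f]
    by (intro borel_measurable_continuous_on[of cnj]) (auto intro: continuous_intros)
  then show ?thesis using f by (simp add: L2_Linf_def)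
qed

quotient_type (overloaded) 'd sqb = "real^('d::finite) \<Rightarrow> complex" / partial: L2_Linf_eq
proof (rule part_equivpI)
  show "\<exists>x. L2_Linf_eq x x"
    using L2_Linf_zero by (auto simp: L2_Linf_eq_def)
  show "symp L2_Linf_eq"
    by (auto simp: symp_def L2_Linf_eq_def)
  show "transp L2_Linf_eq"
    unfolding transp_def L2_Linf_eq_def by (auto elim: eventually_elim2)
qed

instantiation sqb :: (finite) comm_ring
begin

lift_definition zero_sqb :: "'a sqb" is "\<lambda>s. 0"
  by (simp add: L2_Linf_eq_def L2_Linf_zero)

lift_definition plus_sqb :: "'a sqb \<Rightarrow> 'a sqb \<Rightarrow> 'a sqb" is "\<lambda>f g s. f s + g s"
  by (auto simp: L2_Linf_eq_def intro: L2_Linf_add elim: eventually_elim2)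

lift_definition minus_sqb :: "'a sqb \<Rightarrow> 'a sqb \<Rightarrow> 'a sqb" is "\<lambda>f g s. f s - g s"
  by (auto simp: L2_Linf_eq_def intro: L2_Linf_diff elim: eventually_elim2)

lift_definition uminus_sqb :: "'a sqb \<Rightarrow> 'a sqb" is "\<lambda>f s. - f s"
  by (auto simp: L2_Linf_eq_def intro: L2_Linf_minus elim: eventually_mono)

lift_definition times_sqb :: "'a sqb \<Rightarrow> 'a sqb \<Rightarrow> 'a sqb" is "\<lambda>f g s. f s * g s"
  by (auto simp: L2_Linf_eq_def intro: L2_Linf_mult elim: eventually_elim2)

instance
  by standard
    (transfer; auto simp: L2_Linf_eq_def algebra_simps
      intro: L2_Linf_zero L2_Linf_add L2_Linf_diff L2_Linf_minus L2_Linf_mult)+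

end

instantiation sqb :: (finite) complex_vector
begin

lift_definition scaleC_sqb :: "complex \<Rightarrow> 'a sqb \<Rightarrow> 'a sqb" is "\<lambda>a f s. a * f s"
  by (auto simp: L2_Linf_eq_def intro: L2_Linf_scale elim: eventually_mono)

instance
  by standard
    (transfer; auto simp: L2_Linf_eq_def algebra_simps intro: L2_Linf_add L2_Linf_scale
      L2_Linf_scale[where a = "_ + _", unfolded distrib_right]
      L2_Linf_scale[where a = "_ * _", unfolded mult.assoc])+

end

lift_definition conj_sqb :: "'d::finite sqb \<Rightarrow> 'd sqb" is "\<lambda>f s. cnj (f s)"
  by (auto simp: L2_Linf_eq_def intro: L2_Linf_cnj elim: eventually_mono)

lift_definition inner_sqb :: "'d::finite sqb \<Rightarrow> 'd sqb \<Rightarrow> complex"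
  is "\<lambda>f g. LINT s|lborel. cnj (f s) * g s"
proof -
  fix f f' g g' :: "real^'d \<Rightarrow> complex"
  assume f: "L2_Linf_eq f f'" and g: "L2_Linf_eq g g'"
  show "(LINT s|lborel. cnj (f s) * g s) = (LINT s|lborel. cnj (f' s) * g' s)"
    using f g unfolding L2_Linf_eq_def
    by (intro integral_cong_AE borel_measurable_times)
      (auto intro: L2_Linf_measurable L2_Linf_cnj elim: eventually_elim2)
qed

lift_definition norm2_sqb :: "'d::finite sqb \<Rightarrow> real"
  is "\<lambda>f. sqrt (LINT s|lborel. (cmod (f s))\<^sup>2)"
proof -
  fix f f' :: "real^'d \<Rightarrow> complex"
  assume f: "L2_Linf_eq f f'"
  have [measurable]: "f \<in> borel_measurable lborel" "f' \<in> borel_measurable lborel"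
    using f by (auto simp: L2_Linf_eq_def L2_Linf_def)
  have "(LINT s|lborel. (cmod (f s))\<^sup>2) = (LINT s|lborel. (cmod (f' s))\<^sup>2)"
    using f unfolding L2_Linf_eq_def
    by (intro integral_cong_AE) (auto elim: eventually_mono)
  then show "sqrt (LINT s|lborel. (cmod (f s))\<^sup>2) = sqrt (LINT s|lborel. (cmod (f' s))\<^sup>2)"
    by simp
qed

text \<open>The essential supremum below is finite, so \<open>real_of_ereal\<close> loses nothing.\<close>

lift_definition norm_inf_sqb :: "'d::finite sqb \<Rightarrow> real"
  is "\<lambda>f. real_of_ereal (esssup lborel (\<lambda>s. ereal (cmod (f s))))"
proof -
  fix f f' :: "real^'d \<Rightarrow> complex"
  assume f: "L2_Linf_eq f f'"
  have [measurable]: "f \<in> borel_measurable lborel" "f' \<in> borel_measurable lborel"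
    using f by (auto simp: L2_Linf_eq_def L2_Linf_def)
  have "esssup lborel (\<lambda>s. ereal (cmod (f s))) = esssup lborel (\<lambda>s. ereal (cmod (f' s)))"
    using f unfolding L2_Linf_eq_def
    by (intro esssup_AE_cong) (auto elim: eventually_mono)
  then show "real_of_ereal (esssup lborel (\<lambda>s. ereal (cmod (f s))))
      = real_of_ereal (esssup lborel (\<lambda>s. ereal (cmod (f' s))))"
    by simp
qed


section \<open>The free unital *-algebra on the generators\<close>

datatype 'a word = Word (letters: "'a list")

instantiation word :: (type) monoid_add
begin

definition zero_word :: "'a word" where "zero_word = Word []"

definition plus_word :: "'a word \<Rightarrow> 'a word \<Rightarrow> 'a word"
  where "plus_word u v = Word (letters u @ letters v)"

instance
  by standard (simp_all add: zero_word_def plus_word_def)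

end

datatype 'd gen = Bplus "'d sqb" | Bminus "'d sqb" | Num "'d sqb"

text \<open>
  Multiplication of finitely supported functions on a monoid is convolution, so this type is
  the free associative unital algebra on the generators; its unit is the empty word.
\<close>

type_synonym 'd free_alg = "'d gen word \<Rightarrow>\<^sub>0 complex"

instantiation poly_mapping :: (type, complex_vector) complex_vector
begin

definition scaleC_poly_mapping :: "complex \<Rightarrow> ('a \<Rightarrow>\<^sub>0 'b) \<Rightarrow> 'a \<Rightarrow>\<^sub>0 'b"
  where "scaleC_poly_mapping a x = Poly_Mapping.map (scaleC a) x"

instance
proof
  have zero: "a *\<^sub>C (0::'b) = 0" for a
    using scaleC_add_right[of a "0::'b" 0] by simp
  have lookup: "Poly_Mapping.lookup (a *\<^sub>C x) k = a *\<^sub>C Poly_Mapping.lookup x k" for a k and x :: "'a \<Rightarrow>\<^sub>0 'b"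
    unfolding scaleC_poly_mapping_def by transfer (simp add: when_def zero)
  show "a *\<^sub>C (x + y) = a *\<^sub>C x + a *\<^sub>C y" for a and x y :: "'a \<Rightarrow>\<^sub>0 'b"
    by (rule poly_mapping_eqI) (simp add: lookup lookup_add scaleC_add_right)
  show "(a + b) *\<^sub>C x = a *\<^sub>C x + b *\<^sub>C x" for a b and x :: "'a \<Rightarrow>\<^sub>0 'b"
    by (rule poly_mapping_eqI) (simp add: lookup lookup_add scaleC_add_left)
  show "a *\<^sub>C (b *\<^sub>C x) = (a * b) *\<^sub>C x" for a b and x :: "'a \<Rightarrow>\<^sub>0 'b"
    by (rule poly_mapping_eqI) (simp add: lookup scaleC_scaleC)
  show "1 *\<^sub>C x = x" for x :: "'a \<Rightarrow>\<^sub>0 'b"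
    by (rule poly_mapping_eqI) (simp add: lookup scaleC_one)
qed

end

definition gen :: "'d gen \<Rightarrow> 'd free_alg"
  where "gen g = Poly_Mapping.single (Word [g]) 1"

abbreviation "Bp f \<equiv> gen (Bplus f)"
abbreviation "Bm f \<equiv> gen (Bminus f)"
abbreviation "Nn f \<equiv> gen (Num f)"

fun star_gen :: "'d::finite gen \<Rightarrow> 'd gen" where
  "star_gen (Bplus f) = Bminus f"
| "star_gen (Bminus f) = Bplus f"
| "star_gen (Num f) = Num (conj_sqb f)"

definition star_word :: "'d::finite gen word \<Rightarrow> 'd gen word"
  where "star_word w = Word (rev (map star_gen (letters w)))"

lemma conj_sqb_conj_sqb [simp]: "conj_sqb (conj_sqb f) = f"
  by transfer (simp add: L2_Linf_eq_def)

lemma star_gen_star_gen [simp]: "star_gen (star_gen g) = g"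
  by (cases g) simp_all

lemma star_word_star_word [simp]: "star_word (star_word w) = w"
  by (cases w) (simp add: star_word_def rev_map comp_def)

text \<open>
  The conjugate-linear anti-multiplicative extension of \<open>star_gen\<close>. Since \<open>star_word\<close> is an
  involution, the coefficient of \<open>w\<close> in the image is the conjugate of that of \<open>star_word w\<close>.
\<close>

lift_definition star :: "'d::finite free_alg \<Rightarrow> 'd free_alg"
  is "\<lambda>x w. cnj (x (star_word w))"
proof -
  fix x :: "'d gen word \<Rightarrow> complex"
  assume "finite {w. x w \<noteq> 0}"
  then have "finite (star_word ` {w. x w \<noteq> 0})" by (rule finite_imageI)
  moreover have "{w. cnj (x (star_word w)) \<noteq> 0} \<subseteq> star_word ` {w. x w \<noteq> 0}"
  proof
    fix w assume "w \<in> {w. cnj (x (star_word w)) \<noteq> 0}"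
    then show "w \<in> star_word ` {w. x w \<noteq> 0}"
      by (intro image_eqI[of _ _ "star_word w"]) simp_all
  qed
  ultimately show "finite {w. cnj (x (star_word w)) \<noteq> 0}"
    by (rule finite_subset[rotated])
qed

lemma star_star: "star (star x) = x"
  by (rule poly_mapping_eqI) (simp add: star.rep_eq)

lemma star_one: "star 1 = 1"
proof (rule poly_mapping_eqI)
  fix w :: "'a gen word"
  have "star_word w = 0 \<longleftrightarrow> w = 0"
    by (cases w) (simp add: star_word_def zero_word_def)
  then show "Poly_Mapping.lookup (star 1) w = Poly_Mapping.lookup 1 w"
    by (simp add: star.rep_eq lookup_one when_def flip: zero_word_def)
qed

lemma star_gen_eq: "star (gen g) = gen (star_gen g)"
proof (rule poly_mapping_eqI)
  fix w
  have "star_word w = Word [g] \<longleftrightarrow> w = Word [star_gen g]"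
    using star_word_star_word[of w] star_word_star_word[of "Word [g]"]
    by (auto simp: star_word_def)
  then show "Poly_Mapping.lookup (star (gen g)) w = Poly_Mapping.lookup (gen (star_gen g)) w"
    by (auto simp: star.rep_eq gen_def lookup_single when_def)
qed


section \<open>The universal enveloping *-algebra of the RSWN algebra\<close>

abbreviation commutator :: "'d free_alg \<Rightarrow> 'd free_alg \<Rightarrow> 'd free_alg"
  where "commutator x y \<equiv> x * y - y * x"

text \<open>
  The central element \<open>1\<close> of the Lie algebra is identified with the unit of the enveloping algebra.
  The relations involving \<open>Bminus\<close> that are not listed (antilinearity, commutators with \<open>Num\<close>)
  are the adjoints of listed ones and enter through \<open>star\<close> below.
\<close>

inductive_set relators :: "real \<Rightarrow> 'd::finite free_alg set" for c :: real where
  Bp_add: "Bp (f + g) - (Bp f + Bp g) \<in> relators c"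
| Bp_scale: "Bp (a *\<^sub>C f) - a *\<^sub>C Bp f \<in> relators c"
| N_add: "Nn (f + g) - (Nn f + Nn g) \<in> relators c"
| N_scale: "Nn (a *\<^sub>C f) - a *\<^sub>C Nn f \<in> relators c"
| B_Bp: "commutator (Bm f) (Bp g)
    - ((2 * complex_of_real c * inner_sqb f g) *\<^sub>C 1 + 4 *\<^sub>C Nn (conj_sqb f * g)) \<in> relators c"
| N_Bp: "commutator (Nn f) (Bp g) - 2 *\<^sub>C Bp (f * g) \<in> relators c"
| Bp_Bp: "commutator (Bp f) (Bp g) \<in> relators c"
| B_B: "commutator (Bm f) (Bm g) \<in> relators c"
| N_N: "commutator (Nn f) (Nn g) \<in> relators c"

text \<open>
  The two-sided *-ideal generated by the relators. The enveloping algebra is the quotient of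
  the free *-algebra by it; linear maps on the enveloping algebra are treated as linear maps on
  the free algebra that vanish on this ideal.
\<close>

inductive_set rswn_ideal :: "real \<Rightarrow> 'd::finite free_alg set" for c :: real where
  rel: "r \<in> relators c \<Longrightarrow> r \<in> rswn_ideal c"
| star_rel: "r \<in> relators c \<Longrightarrow> star r \<in> rswn_ideal c"
| zero: "0 \<in> rswn_ideal c"
| add: "x \<in> rswn_ideal c \<Longrightarrow> y \<in> rswn_ideal c \<Longrightarrow> x + y \<in> rswn_ideal c"
| mult: "x \<in> rswn_ideal c \<Longrightarrow> a * x * b \<in> rswn_ideal c"


section \<open>The Fock state and its GNS space\<close>

locale fock_state =
  fixes c :: real and \<omega> :: "'d::finite free_alg \<Rightarrow> complex"
  assumes linear: "clinear \<omega>"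
    and vanishes: "x \<in> rswn_ideal c \<Longrightarrow> \<omega> x = 0"
    and positive: "\<omega> (star x * x) \<in> \<real>\<^sub>\<ge>\<^sub>0"
    and one: "\<omega> 1 = 1"
    and Bm: "\<omega> (x * Bm f) = 0"
    and Nn: "\<omega> (x * Nn f) = 0"

text \<open>
  The GNS triple \<open>('h, \<pi>, \<Phi>)\<close> of \<open>\<omega>\<close>. The operators \<open>\<pi> x\<close> are in general unbounded and only
  their values on the dense domain \<open>gns_domain \<pi> \<Phi>\<close> matter.
\<close>

definition gns_domain :: "('d free_alg \<Rightarrow> 'h \<Rightarrow> 'h) \<Rightarrow> 'h \<Rightarrow> 'h set"
  where "gns_domain \<pi> \<Phi> = range (\<lambda>x. \<pi> x \<Phi>)"

locale gns_triple =
  fixes c :: real and \<omega> :: "'d::finite free_alg \<Rightarrow> complex"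
    and \<pi> :: "'d free_alg \<Rightarrow> 'h::complex_hilbert \<Rightarrow> 'h" and \<Phi> :: 'h
  assumes cyclic: "closure (gns_domain \<pi> \<Phi>) = UNIV"
    and vector_state: "\<omega> x = cinner \<Phi> (\<pi> x \<Phi>)"
    and vacuum: "\<pi> 1 \<Phi> = \<Phi>"
    and op_add: "\<lbrakk>u \<in> gns_domain \<pi> \<Phi>; v \<in> gns_domain \<pi> \<Phi>\<rbrakk> \<Longrightarrow> \<pi> x (u + v) = \<pi> x u + \<pi> x v"
    and op_scale: "u \<in> gns_domain \<pi> \<Phi> \<Longrightarrow> \<pi> x (a *\<^sub>C u) = a *\<^sub>C \<pi> x u"
    and rep_add: "u \<in> gns_domain \<pi> \<Phi> \<Longrightarrow> \<pi> (x + y) u = \<pi> x u + \<pi> y u"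
    and rep_scale: "u \<in> gns_domain \<pi> \<Phi> \<Longrightarrow> \<pi> (a *\<^sub>C x) u = a *\<^sub>C \<pi> x u"
    and rep_mult: "u \<in> gns_domain \<pi> \<Phi> \<Longrightarrow> \<pi> (x * y) u = \<pi> x (\<pi> y u)"
    and rep_vanishes: "\<lbrakk>u \<in> gns_domain \<pi> \<Phi>; x \<in> rswn_ideal c\<rbrakk> \<Longrightarrow> \<pi> x u = 0"
    and rep_star: "\<lbrakk>u \<in> gns_domain \<pi> \<Phi>; v \<in> gns_domain \<pi> \<Phi>\<rbrakk>
      \<Longrightarrow> cinner (\<pi> x u) v = cinner u (\<pi> (star x) v)"


section \<open>Quadratic exponential vectors and quadratic second quantization\<close>

definition qexp_term ::
  "('d free_alg \<Rightarrow> 'h::complex_hilbert \<Rightarrow> 'h) \<Rightarrow> 'h \<Rightarrow> 'd::finite sqb \<Rightarrow> nat \<Rightarrow> 'h"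
  where "qexp_term \<pi> \<Phi> f n = (1 / fact n) *\<^sub>C (\<pi> (Bp f) ^^ n) \<Phi>"

definition qexp_exists ::
  "('d free_alg \<Rightarrow> 'h::complex_hilbert \<Rightarrow> 'h) \<Rightarrow> 'h \<Rightarrow> 'd::finite sqb \<Rightarrow> bool"
  where "qexp_exists \<pi> \<Phi> f \<longleftrightarrow> summable (qexp_term \<pi> \<Phi> f)"

definition qexp ::
  "('d free_alg \<Rightarrow> 'h::complex_hilbert \<Rightarrow> 'h) \<Rightarrow> 'h \<Rightarrow> 'd::finite sqb \<Rightarrow> 'h"
  where "qexp \<pi> \<Phi> f = suminf (qexp_term \<pi> \<Phi> f)"

text \<open>
  The graph of \<open>\<Gamma>\<^sub>2(T)\<close>, as a linear relation on the span of the exponential vectors;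
  it is the graph of a map iff it is single-valued.
\<close>

definition Gamma2 ::
  "('d free_alg \<Rightarrow> 'h::complex_hilbert \<Rightarrow> 'h) \<Rightarrow> 'h \<Rightarrow> ('d::finite sqb \<Rightarrow> 'd sqb) \<Rightarrow> ('h \<times> 'h) set"
  where "Gamma2 \<pi> \<Phi> T =
    {(\<Sum>f\<in>F. a f *\<^sub>C qexp \<pi> \<Phi> f, \<Sum>f\<in>F. a f *\<^sub>C qexp \<pi> \<Phi> (T f)) | F a.
      finite F \<and> (\<forall>f\<in>F. norm_inf_sqb f < 1/2)}"

definition Gamma2_well_defined ::
  "('d free_alg \<Rightarrow> 'h::complex_hilbert \<Rightarrow> 'h) \<Rightarrow> 'h \<Rightarrow> ('d::finite sqb \<Rightarrow> 'd sqb) \<Rightarrow> bool"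
  where "Gamma2_well_defined \<pi> \<Phi> T \<longleftrightarrow>
    (\<forall>f. norm_inf_sqb f < 1/2 \<longrightarrow> qexp_exists \<pi> \<Phi> f \<and> qexp_exists \<pi> \<Phi> (T f))
    \<and> single_valued (Gamma2 \<pi> \<Phi> T)"

definition Gamma2_contraction ::
  "('d free_alg \<Rightarrow> 'h::complex_hilbert \<Rightarrow> 'h) \<Rightarrow> 'h \<Rightarrow> ('d::finite sqb \<Rightarrow> 'd sqb) \<Rightarrow> bool"
  where "Gamma2_contraction \<pi> \<Phi> T \<longleftrightarrow>
    Gamma2_well_defined \<pi> \<Phi> T
    \<and> (\<exists>G. clinear G \<and> (\<forall>x. norm (G x) \<le> norm x) \<and> (\<forall>(x, y) \<in> Gamma2 \<pi> \<Phi> T. G x = y))"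

end

theory Submission
  imports Defs
begin

text \<open>
  Write \<open>\<psi>\<^sub>n(f)\<close> for the \<open>n\<close>-th term of the series of the exponential vector of \<open>f\<close>. The commutation
  relations show that different levels \<open>n\<close> are orthogonal and that the Gram kernels
  \<open>p\<^sub>n(f, g) = \<langle>\<psi>\<^sub>n(f), \<psi>\<^sub>n(g)\<rangle>\<close> satisfy
  \<open>(n + 1) p\<^sub>n\<^sub>+\<^sub>1(f, g) = (\<Sum>k\<le>n. 2 c 4\<^sup>k \<langle>f\<^sup>k\<^sup>+\<^sup>1, g\<^sup>k\<^sup>+\<^sup>1\<rangle> p\<^sub>n\<^sub>-\<^sub>k(f, g))\<close>, the coefficientwise form of the
  exponential formula for the inner product of two exponential vectors.

  Since \<open>(T f)\<^sup>k\<^sup>+\<^sup>1 = \<phi>\<^sup>k T(f\<^sup>k\<^sup>+\<^sup>1)\<close> and both \<open>T\<close> and multiplication by \<open>\<phi>\<close> contract the \<open>L\<^sup>2\<close> norm, the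
  kernel \<open>\<langle>f\<^sup>k\<^sup>+\<^sup>1, g\<^sup>k\<^sup>+\<^sup>1\<rangle> - \<langle>(T f)\<^sup>k\<^sup>+\<^sup>1, (T g)\<^sup>k\<^sup>+\<^sup>1\<rangle>\<close> is positive semidefinite. By the Schur product theorem
  and induction on \<open>n\<close>, so is \<open>p\<^sub>n(f, g) - p\<^sub>n(T f, T g)\<close>, which means that \<open>\<psi>\<^sub>n(f) \<mapsto> \<psi>\<^sub>n(T f)\<close> is a
  contraction on every level. The contraction so obtained on the span of the exponential vectors
  extends to the whole space through the orthogonal projection onto the closure of that span.
\<close>


section \<open>Complex Hilbert spaces\<close>

interpretation cvec: vector_space "scaleC :: complex \<Rightarrow> 'a \<Rightarrow> 'a::complex_vector"
  by standard (simp_all add: scaleC_add_right scaleC_add_left scaleC_scaleC scaleC_one)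

lemma clinear_iff:
  "clinear G \<longleftrightarrow> (\<forall>x y. G (x + y) = G x + G y) \<and> (\<forall>a x. G (a *\<^sub>C x) = a *\<^sub>C G x)"
  by (simp add: linear_iff_module_hom module_hom_iff cvec.module_axioms)

lemma cinner_add_left: "cinner (x + y) z = cinner x z + cinner (y::'h::complex_hilbert) z"
  by (metis cinner_add_right cinner_commute complex_cnj_add)

lemma cinner_scaleC_left: "cinner (a *\<^sub>C x) (y::'h::complex_hilbert) = cnj a * cinner x y"
  by (metis cinner_commute cinner_scaleC_right complex_cnj_mult)

lemma cinner_zero_right [simp]: "cinner x (0::'h::complex_hilbert) = 0"
  by (metis cvec.scale_zero_left cinner_scaleC_right mult_zero_left)

lemma cinner_zero_left [simp]: "cinner (0::'h::complex_hilbert) x = 0"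
  by (metis cinner_commute cinner_zero_right complex_cnj_zero)

lemma cinner_diff_right: "cinner x (y - z) = cinner x y - cinner (x::'h::complex_hilbert) z"
  by (metis add_diff_cancel_right' cinner_add_right diff_add_cancel)

lemma cinner_diff_left: "cinner (x - y) z = cinner x z - cinner (y::'h::complex_hilbert) z"
  by (metis add_diff_cancel_right' cinner_add_left diff_add_cancel)

lemma cinner_sum_right: "cinner (x::'h::complex_hilbert) (\<Sum>i\<in>A. f i) = (\<Sum>i\<in>A. cinner x (f i))"
  by (induction A rule: infinite_finite_induct) (simp_all add: cinner_add_right)

lemma cinner_sum_left: "cinner (\<Sum>i\<in>A. f i) (x::'h::complex_hilbert) = (\<Sum>i\<in>A. cinner (f i) x)"
  by (induction A rule: infinite_finite_induct) (simp_all add: cinner_add_left)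

lemma cinner_self: "cinner x (x::'h::complex_hilbert) = complex_of_real ((norm x)\<^sup>2)"
  using cinner_ge_zero[of x]
  by (auto simp: norm_eq_sqrt_cinner complex_nonneg_Reals_iff complex_eq_iff)

lemma norm_sq_cinner: "(norm (x::'h::complex_hilbert))\<^sup>2 = Re (cinner x x)"
  by (simp add: cinner_self)

lemma norm_scaleC: "norm (a *\<^sub>C (x::'h::complex_hilbert)) = cmod a * norm x"
proof -
  have "complex_of_real ((norm (a *\<^sub>C x))\<^sup>2) = complex_of_real ((cmod a * norm x)\<^sup>2)"
    unfolding cinner_self[symmetric] cinner_scaleC_left cinner_scaleC_right
    by (simp add: cinner_self power_mult_distrib complex_norm_square mult_ac del: of_real_power)
  then have "(norm (a *\<^sub>C x))\<^sup>2 = (cmod a * norm x)\<^sup>2"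
    using of_real_eq_iff by blast
  then show ?thesis by simp
qed

lemma norm_add_sq:
  "(norm (x + y))\<^sup>2 = (norm x)\<^sup>2 + (norm y)\<^sup>2 + 2 * Re (cinner x (y::'h::complex_hilbert))"
  using arg_cong[OF cinner_commute[of x y], of Re]
  by (simp add: norm_sq_cinner cinner_add_left cinner_add_right)

lemma norm_diff_sq:
  "(norm (x - y))\<^sup>2 = (norm x)\<^sup>2 + (norm y)\<^sup>2 - 2 * Re (cinner x (y::'h::complex_hilbert))"
  using arg_cong[OF cinner_commute[of x y], of Re]
  by (simp add: norm_sq_cinner cinner_diff_left cinner_diff_right)

lemma norm_sq_sum_orthogonal:
  fixes w :: "nat \<Rightarrow> 'h::complex_hilbert"
  assumes "\<And>m n. m \<noteq> n \<Longrightarrow> cinner (w m) (w n) = 0"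
  shows "(norm (\<Sum>n<N. w n))\<^sup>2 = (\<Sum>n<N. (norm (w n))\<^sup>2)"
proof (induction N)
  case (Suc N)
  have "cinner (\<Sum>n<N. w n) (w N) = 0"
    unfolding cinner_sum_left by (rule sum.neutral) (use assms in auto)
  then show ?case using Suc by (simp add: norm_add_sq)
qed simp

lemma tendsto_scaleC:
  assumes "X \<longlonglongrightarrow> (x::'h::complex_hilbert)"
  shows "(\<lambda>n. a *\<^sub>C X n) \<longlonglongrightarrow> a *\<^sub>C x"
proof -
  have "(\<lambda>n. cmod a * norm (X n - x)) \<longlonglongrightarrow> cmod a * 0"
    using assms by (intro tendsto_mult_left) (simp add: LIM_zero tendsto_norm_zero)
  then have "(\<lambda>n. norm (a *\<^sub>C X n - a *\<^sub>C x)) \<longlonglongrightarrow> 0"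
    by (simp add: norm_scaleC flip: cvec.scale_right_diff_distrib)
  then show ?thesis using LIM_zero_cancel tendsto_norm_zero_iff by blast
qed

section \<open>Extension of a contractive linear relation to a contraction of the whole
  space\<close>

locale contractive_relation =
  fixes R :: "('h::complex_hilbert \<times> 'h) set"
  assumes zero: "(0, 0) \<in> R"
    and add: "\<lbrakk>(x, y) \<in> R; (x', y') \<in> R\<rbrakk> \<Longrightarrow> (x + x', y + y') \<in> R"
    and scale: "(x, y) \<in> R \<Longrightarrow> (a *\<^sub>C x, a *\<^sub>C y) \<in> R"
    and contraction: "(x, y) \<in> R \<Longrightarrow> norm y \<le> norm x"
begin

lemma diff: "\<lbrakk>(x, y) \<in> R; (x', y') \<in> R\<rbrakk> \<Longrightarrow> (x - x', y - y') \<in> R"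
  using add[of x y "- x'" "- y'"] scale[of x' y' "-1"] by simp

text \<open>Two images of one vector differ by an image of 0, which contractivity forces to vanish.
  So the relation need not be known to be a function in advance.\<close>

lemma single_valued: "single_valued R"
proof (rule single_valuedI)
  fix x y z assume "(x, y) \<in> R" "(x, z) \<in> R"
  from contraction[OF diff[OF this]] show "y = z" by simp
qed

definition orthogonal :: "'h \<Rightarrow> bool"
  where "orthogonal z \<longleftrightarrow> (\<forall>(m, _) \<in> R. cinner m z = 0)"

text \<open>\<open>p\<close> is the orthogonal projection of \<open>x\<close> onto the closure of
  the domain of \<open>R\<close>, and \<open>y\<close> is the value at \<open>p\<close> of the
  continuous extension of \<open>R\<close>.\<close>

definition extension :: "'h \<Rightarrow> 'h \<Rightarrow> bool"
  where "extension x y \<longleftrightarrow> (\<exists>P Y p. (\<forall>n. (P n, Y n) \<in> R) \<and> P \<longlonglongrightarrow> p \<and> Y \<longlonglongrightarrow> y \<and> orthogonal (x - p))"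

lemma extension_add:
  assumes "extension x y" "extension x' y'"
  shows "extension (x + x') (y + y')"
proof -
  obtain P Y p where 1: "\<And>n. (P n, Y n) \<in> R" "P \<longlonglongrightarrow> p" "Y \<longlonglongrightarrow> y" "orthogonal (x - p)"
    using assms(1) by (auto simp: extension_def)
  obtain P' Y' p' where 2: "\<And>n. (P' n, Y' n) \<in> R" "P' \<longlonglongrightarrow> p'" "Y' \<longlonglongrightarrow> y'" "orthogonal (x' - p')"
    using assms(2) by (auto simp: extension_def)
  have "orthogonal ((x + x') - (p + p'))"
    using 1(4) 2(4) by (fastforce simp: orthogonal_def cinner_diff_right cinner_add_right)
  then show ?thesis
    unfolding extension_def using 1 2
    by (intro exI[of _ "\<lambda>n. P n + P' n"] exI[of _ "\<lambda>n. Y n + Y' n"] exI[of _ "p + p'"])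
      (auto intro: add tendsto_add)
qed

lemma extension_scale:
  assumes "extension x y"
  shows "extension (a *\<^sub>C x) (a *\<^sub>C y)"
proof -
  obtain P Y p where 1: "\<And>n. (P n, Y n) \<in> R" "P \<longlonglongrightarrow> p" "Y \<longlonglongrightarrow> y" "orthogonal (x - p)"
    using assms(1) by (auto simp: extension_def)
  have "orthogonal (a *\<^sub>C x - a *\<^sub>C p)"
    using 1(4) by (fastforce simp: orthogonal_def cinner_scaleC_right simp flip: cvec.scale_right_diff_distrib)
  then show ?thesis
    unfolding extension_def using 1
    by (intro exI[of _ "\<lambda>n. a *\<^sub>C P n"] exI[of _ "\<lambda>n. a *\<^sub>C Y n"] exI[of _ "a *\<^sub>C p"])
      (auto intro: scale tendsto_scaleC)
qed

text \<open>\<open>P n\<close> is orthogonal to \<open>x - p\<close>, so by Pythagoras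
  \<open>norm (Y n) \<le> norm (P n) \<le> norm (P n + (x - p))\<close>, and the last term tends to
  \<open>norm x\<close>.\<close>

lemma extension_contraction:
  assumes "extension x y"
  shows "norm y \<le> norm x"
proof -
  obtain P Y p where P: "\<And>n. (P n, Y n) \<in> R" "P \<longlonglongrightarrow> p" "Y \<longlonglongrightarrow> y" "orthogonal (x - p)"
    using assms(1) by (auto simp: extension_def)
  have "(norm (P n + (x - p)))\<^sup>2 = (norm (P n))\<^sup>2 + (norm (x - p))\<^sup>2" for n
  proof -
    have "cinner (P n) (x - p) = 0"
      using P(1)[of n] P(4) by (auto simp: orthogonal_def)
    then show ?thesis by (simp add: norm_add_sq)
  qed
  then have "norm (P n) \<le> norm (P n + (x - p))" for n
    by (metis abs_norm_cancel le_add_same_cancel1 power2_le_iff_abs_le zero_le_power2 norm_ge_zero)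
  then have *: "norm (Y n) \<le> norm (P n + (x - p))" for n
    using contraction[OF P(1)[of n]] order_trans by blast
  have "(\<lambda>n. norm (P n + (x - p))) \<longlonglongrightarrow> norm (p + (x - p))"
    by (intro tendsto_intros P)
  moreover have "(\<lambda>n. norm (Y n)) \<longlonglongrightarrow> norm y"
    by (intro tendsto_intros P)
  ultimately have "norm y \<le> norm (p + (x - p))"
    using * by (intro LIMSEQ_le) auto
  then show ?thesis by simp
qed

lemma extension_of_mem:
  assumes "(x, y) \<in> R" shows "extension x y"
  unfolding extension_def using assms
  by (intro exI[of _ "\<lambda>n. x"] exI[of _ "\<lambda>n. y"] exI[of _ x]) (auto simp: orthogonal_def)

text \<open>Subtracting a small multiple of \<open>cinner m z *\<^sub>C m\<close> would shorten
  \<open>z\<close> if that inner product were nonzero.\<close>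

lemma orthogonal_if_nearest:
  assumes "\<And>m y. (m, y) \<in> R \<Longrightarrow> norm z \<le> norm (z - m)"
  shows "orthogonal z"
proof -
  have "cinner m z = 0" if "(m, y) \<in> R" for m y
  proof -
    \<comment> \<open>The optimal factor would be \<open>1 / (norm m)\<^sup>2\<close>; the added 1
      avoids division by zero at \<open>m = 0\<close> and keeps
      \<open>s * (norm m)\<^sup>2 - 2\<close> negative, which is what the final estimate
      needs.\<close>
    define s where "s = 1 / (1 + (norm m)\<^sup>2)"
    define t where "t = complex_of_real s * cinner m z"
    have s: "s > 0" "s * (norm m)\<^sup>2 < 1"
      by (auto simp: s_def divide_simps add_pos_nonneg)
    have "norm z \<le> norm (z - t *\<^sub>C m)"
      by (rule assms[OF scale[OF that]])
    then have "(norm z)\<^sup>2 \<le> (norm (z - t *\<^sub>C m))\<^sup>2"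
      by (simp add: power_mono)
    also have "\<dots> = (norm z)\<^sup>2 + (s * cmod (cinner m z) * norm m)\<^sup>2 - 2 * (s * (cmod (cinner m z))\<^sup>2)"
    proof -
      have "t * cnj (cinner m z) = complex_of_real (s * (cmod (cinner m z))\<^sup>2)"
        by (simp add: t_def complex_norm_square mult_ac del: of_real_power)
      then have "Re (cinner z (t *\<^sub>C m)) = s * (cmod (cinner m z))\<^sup>2"
        by (metis Re_complex_of_real cinner_commute cinner_scaleC_right)
      moreover have "norm (t *\<^sub>C m) = s * cmod (cinner m z) * norm m"
        using s by (simp add: norm_scaleC t_def norm_mult)
      ultimately show ?thesis by (simp add: norm_diff_sq)
    qed
    finally have "0 \<le> s * (cmod (cinner m z))\<^sup>2 * (s * (norm m)\<^sup>2 - 2)"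
      by (simp add: power_mult_distrib power2_eq_square algebra_simps)
    then have "s * (cmod (cinner m z))\<^sup>2 \<le> 0"
      using s by (simp add: zero_le_mult_iff)
    then show ?thesis using s by (simp add: mult_le_0_iff)
  qed
  then show ?thesis by (auto simp: orthogonal_def)
qed

text \<open>Parallelogram law: the midpoint of \<open>m\<close> and \<open>m'\<close> also has
  distance at least \<open>d\<close> from \<open>x\<close>, which leaves little room for
  \<open>m - m'\<close>. Hence minimizing sequences are Cauchy.\<close>

lemma nearest_pair_dist:
  assumes lower: "\<And>m y. (m, y) \<in> R \<Longrightarrow> d \<le> norm (x - m)" and "0 \<le> d"
    and m: "(m, y) \<in> R" "(norm (x - m))\<^sup>2 \<le> d\<^sup>2 + e"
    and m': "(m', y') \<in> R" "(norm (x - m'))\<^sup>2 \<le> d\<^sup>2 + e"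
  shows "(norm (m - m'))\<^sup>2 \<le> 4 * e"
proof -
  have "d \<le> norm (x - (1/2) *\<^sub>C (m + m'))"
    by (rule lower[OF scale[OF add[OF m(1) m'(1)]]])
  also have "x - (1/2) *\<^sub>C (m + m') = (1/2) *\<^sub>C ((x - m) + (x - m'))"
    using cvec.scale_left_distrib[of "1/2" "1/2" x]
    by (simp add: cvec.scale_right_distrib cvec.scale_right_diff_distrib)
  finally have "2 * d \<le> norm ((x - m) + (x - m'))"
    by (simp add: norm_scaleC)
  then have "(2 * d)\<^sup>2 \<le> (norm ((x - m) + (x - m')))\<^sup>2"
    using \<open>0 \<le> d\<close> by (intro power_mono) auto
  moreover have "(norm ((x - m) + (x - m')))\<^sup>2 + (norm ((x - m) - (x - m')))\<^sup>2
      = 2 * (norm (x - m))\<^sup>2 + 2 * (norm (x - m'))\<^sup>2"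
    unfolding norm_add_sq norm_diff_sq by simp
  moreover have "(x - m) - (x - m') = m' - m" by simp
  ultimately have "(norm (m' - m))\<^sup>2 \<le> 4 * e"
    using m(2) m'(2) by (simp add: power_mult_distrib)
  then show ?thesis by (simp add: norm_minus_commute)
qed

text \<open>A sequence in the domain minimizing the distance to \<open>x\<close> is Cauchy,
  contractivity makes its images Cauchy too, and completeness supplies both limits.\<close>

lemma extension_exists: "\<exists>y. extension x y"
proof -
  define d where "d = (INF r \<in> R. norm (x - fst r))"
  have bdd: "bdd_below ((\<lambda>r. norm (x - fst r)) ` R)"
    by (rule bdd_belowI[of _ 0]) auto
  have lower: "d \<le> norm (x - m)" if "(m, y) \<in> R" for m y
    unfolding d_def using cINF_lower[OF bdd that] by simp
  have d0: "0 \<le> d"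
    unfolding d_def using zero by (intro cINF_greatest) auto
  have ex: "\<exists>m y. (m, y) \<in> R \<and> (norm (x - m))\<^sup>2 < d\<^sup>2 + 1 / real (Suc n)" for n
  proof -
    have "d < sqrt (d\<^sup>2 + 1 / real (Suc n))"
      using d0 by (simp add: real_less_rsqrt)
    then obtain r where "r \<in> R" "norm (x - fst r) < sqrt (d\<^sup>2 + 1 / real (Suc n))"
      using cINF_less_iff[OF _ bdd, of "sqrt (d\<^sup>2 + 1 / real (Suc n))"] zero
      unfolding d_def by blast
    then obtain m y where "(m, y) \<in> R" "norm (x - m) < sqrt (d\<^sup>2 + 1 / real (Suc n))"
      by (cases r) auto
    moreover from this have "(norm (x - m))\<^sup>2 < (sqrt (d\<^sup>2 + 1 / real (Suc n)))\<^sup>2"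
      by (intro power_strict_mono) auto
    ultimately show ?thesis by (auto simp: add_nonneg_nonneg)
  qed
  then obtain P Y where PY: "\<And>n. (P n, Y n) \<in> R"
    and near: "\<And>n. (norm (x - P n))\<^sup>2 < d\<^sup>2 + 1 / real (Suc n)"
    by metis
  have close: "norm (P i - P j) \<le> sqrt (4 / real (Suc N))" if "N \<le> i" "N \<le> j" for i j N
  proof -
    have "1 / real (Suc i) \<le> 1 / real (Suc N)" "1 / real (Suc j) \<le> 1 / real (Suc N)"
      using that by (auto intro!: divide_left_mono)
    then have "(norm (P i - P j))\<^sup>2 \<le> 4 * (1 / real (Suc N))"
      using near[of i] near[of j] PY[of i] PY[of j]
      by (intro nearest_pair_dist[where d = d and x = x and y = "Y i" and y' = "Y j"]) (auto intro: lower d0)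
    then show ?thesis by (simp add: real_le_rsqrt)
  qed
  have small: "\<exists>N. sqrt (4 / real (Suc N)) < e" if "e > 0" for e
  proof -
    have "(\<lambda>N. sqrt (4 / real (Suc N))) \<longlonglongrightarrow> sqrt 0"
      by (intro tendsto_real_sqrt LIMSEQ_Suc lim_const_over_n)
    then have "eventually (\<lambda>N. sqrt (4 / real (Suc N)) < e) sequentially"
      using that by (intro order_tendstoD) auto
    then show ?thesis by (meson eventually_sequentially order_refl)
  qed
  have "Cauchy P"
  proof (rule CauchyI)
    fix e :: real assume "e > 0"
    then obtain N where "sqrt (4 / real (Suc N)) < e" using small by blast
    then show "\<exists>M. \<forall>m\<ge>M. \<forall>n\<ge>M. norm (P m - P n) < e"
      using close[of N] order_le_less_trans by blast
  qed
  moreover have "Cauchy Y"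
  proof (rule CauchyI)
    fix e :: real assume "e > 0"
    then obtain N where "sqrt (4 / real (Suc N)) < e" using small by blast
    then show "\<exists>M. \<forall>m\<ge>M. \<forall>n\<ge>M. norm (Y m - Y n) < e"
      using close[of N] contraction[OF diff[OF PY PY]] order_le_less_trans by meson
  qed
  ultimately obtain p y where p: "P \<longlonglongrightarrow> p" and y: "Y \<longlonglongrightarrow> y"
    by (auto simp: Cauchy_convergent_iff convergent_def)
  have "(norm (x - p))\<^sup>2 \<le> d\<^sup>2"
  proof (rule LIMSEQ_le)
    show "(\<lambda>n. (norm (x - P n))\<^sup>2) \<longlonglongrightarrow> (norm (x - p))\<^sup>2"
      by (intro tendsto_intros p)
    show "(\<lambda>n. d\<^sup>2 + 1 / real (Suc n)) \<longlonglongrightarrow> d\<^sup>2"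
      using tendsto_add[OF tendsto_const LIMSEQ_Suc[OF lim_const_over_n], of "d\<^sup>2" 1] by simp
    show "\<exists>N. \<forall>n\<ge>N. (norm (x - P n))\<^sup>2 \<le> d\<^sup>2 + 1 / real (Suc n)"
      using near less_imp_le by blast
  qed
  then have xp: "norm (x - p) \<le> d" using d0 by (simp add: power2_le_iff_abs_le)
  have "orthogonal (x - p)"
  proof (rule orthogonal_if_nearest)
    \<comment> \<open>\<open>P n + m\<close> lies in the domain, so its distance to \<open>x\<close>
      is at least \<open>d\<close>; this bound passes to the limit \<open>p + m\<close>.\<close>
    fix m w assume "(m, w) \<in> R"
    then have "d \<le> norm (x - P n - m)" for n
      using lower[OF add[OF PY[of n]]] by (simp add: diff_diff_eq)
    moreover have "(\<lambda>n. norm (x - P n - m)) \<longlonglongrightarrow> norm (x - p - m)"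
      by (intro tendsto_intros p)
    ultimately have "d \<le> norm (x - p - m)"
      by (intro LIMSEQ_le_const) auto
    then show "norm (x - p) \<le> norm (x - p - m)" using xp by simp
  qed
  then show ?thesis unfolding extension_def using PY p y by blast
qed

text \<open>The difference of the two pairs is an extension pair over 0, so its second entry has
  norm at most 0.\<close>

lemma extension_unique: "extension x y \<Longrightarrow> extension x z \<Longrightarrow> y = z"
  using extension_contraction[OF extension_add[OF _ extension_scale, of x y x z "-1"]] by simp

theorem linear_contraction_extension:
  "\<exists>G. clinear G \<and> (\<forall>x. norm (G x) \<le> norm x) \<and> (\<forall>(x, y) \<in> R. G x = y)"
proof -
  obtain G where G: "\<And>x. extension x (G x)" using extension_exists by metis
  have eq: "G x = y" if "extension x y" for x y
    using extension_unique[OF G that] .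
  \<comment> \<open>\<open>G\<close> is chosen pointwise; it is linear because sums and multiples of
    extension pairs are extension pairs and values are unique.\<close>
  have "clinear G"
    unfolding clinear_iff by (auto intro!: eq extension_add extension_scale G)
  moreover have "\<forall>(x, y) \<in> R. G x = y"
    by (auto intro: eq extension_of_mem)
  ultimately show ?thesis using extension_contraction[OF G] by blast
qed

end


section \<open>Positive semidefinite kernels\<close>

definition kernel_form :: "'a set \<Rightarrow> ('a \<Rightarrow> 'a \<Rightarrow> complex) \<Rightarrow> ('a \<Rightarrow> complex) \<Rightarrow> complex"
  where "kernel_form F K a = (\<Sum>f\<in>F. \<Sum>g\<in>F. cnj (a f) * a g * K f g)"

text \<open>Hermitian symmetry makes the form real, so \<open>Re\<close> discards nothing.\<close>

definition pd_kernel :: "'a set \<Rightarrow> ('a \<Rightarrow> 'a \<Rightarrow> complex) \<Rightarrow> bool"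
  where "pd_kernel F K \<longleftrightarrow>
    (\<forall>f\<in>F. \<forall>g\<in>F. K g f = cnj (K f g)) \<and> (\<forall>a. 0 \<le> Re (kernel_form F K a))"

lemma pd_kernel_form: "pd_kernel F K \<Longrightarrow> 0 \<le> Re (kernel_form F K a)"
  by (simp add: pd_kernel_def)

lemma pd_kernel_hermitian: "\<lbrakk>pd_kernel F K; f \<in> F; g \<in> F\<rbrakk> \<Longrightarrow> K g f = cnj (K f g)"
  unfolding pd_kernel_def by blast

lemma kernel_form_cong:
  "(\<And>f g. f \<in> F \<Longrightarrow> g \<in> F \<Longrightarrow> K f g = L f g) \<Longrightarrow> kernel_form F K a = kernel_form F L a"
  by (simp add: kernel_form_def)

lemma kernel_form_add:
  "kernel_form F (\<lambda>f g. K f g + L f g) a = kernel_form F K a + kernel_form F L a"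
  by (simp add: kernel_form_def distrib_left sum.distrib)

lemma kernel_form_diff:
  "kernel_form F (\<lambda>f g. K f g - L f g) a = kernel_form F K a - kernel_form F L a"
  by (simp add: kernel_form_def right_diff_distrib sum_subtractf)

lemma kernel_form_scale:
  "kernel_form F (\<lambda>f g. s * K f g) a = s * kernel_form F K a"
  by (simp add: kernel_form_def sum_distrib_left mult_ac)

lemma kernel_form_sum:
  "kernel_form F (\<lambda>f g. \<Sum>i\<in>I. K i f g) a = (\<Sum>i\<in>I. kernel_form F (K i) a)"
  by (induction I rule: infinite_finite_induct)
    (simp_all add: kernel_form_add, simp_all add: kernel_form_def)

text \<open>The rank-one case of the Schur product: the factor \<open>u\<close> is absorbed into the
  coefficients.\<close>

lemma kernel_form_rank_one:
  "kernel_form F (\<lambda>f g. K f g * (cnj (u f) * u g)) a = kernel_form F K (\<lambda>f. a f * u f)"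
  by (simp add: kernel_form_def mult_ac)

lemma kernel_form_one:
  "kernel_form F (\<lambda>f g. cnj (u f) * u g) a = complex_of_real ((cmod (\<Sum>f\<in>F. a f * u f))\<^sup>2)"
  unfolding complex_norm_square kernel_form_def
  by (simp add: sum_product mult_ac) (subst sum.swap, simp add: mult_ac)

lemma pd_kernel_cong:
  assumes "pd_kernel F K" and eq: "\<And>f g. f \<in> F \<Longrightarrow> g \<in> F \<Longrightarrow> K f g = L f g"
  shows "pd_kernel F L"
proof -
  have "kernel_form F K a = kernel_form F L a" for a by (rule kernel_form_cong) (rule eq)
  moreover have "L g f = cnj (L f g)" if "f \<in> F" "g \<in> F" for f g
    using assms(1) eq that unfolding pd_kernel_def by metis
  ultimately show ?thesis using assms(1) unfolding pd_kernel_def by metis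
qed

lemma pd_kernel_add:
  "pd_kernel F K \<Longrightarrow> pd_kernel F L \<Longrightarrow> pd_kernel F (\<lambda>f g. K f g + L f g)"
  unfolding pd_kernel_def kernel_form_add by (metis add_nonneg_nonneg complex_cnj_add plus_complex.sel(1))

lemma pd_kernel_scale:
  "pd_kernel F K \<Longrightarrow> 0 \<le> s \<Longrightarrow> pd_kernel F (\<lambda>f g. complex_of_real s * K f g)"
proof -
  assume pd: "pd_kernel F K" and s: "0 \<le> s"
  have "0 \<le> Re (complex_of_real s * kernel_form F K a)" for a
    using pd_kernel_form[OF pd] s by simp
  moreover have "complex_of_real s * K g f = cnj (complex_of_real s * K f g)"
    if "f \<in> F" "g \<in> F" for f g
    unfolding pd_kernel_hermitian[OF pd that] by simp
  ultimately show ?thesis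
    unfolding pd_kernel_def kernel_form_scale by blast
qed

lemma pd_kernel_sum:
  assumes "\<And>i. i \<in> I \<Longrightarrow> pd_kernel F (K i)"
  shows "pd_kernel F (\<lambda>f g. \<Sum>i\<in>I. K i f g)"
proof -
  have "(\<Sum>i\<in>I. K i g f) = cnj (\<Sum>i\<in>I. K i f g)" if "f \<in> F" "g \<in> F" for f g
    unfolding cnj_sum using assms that unfolding pd_kernel_def by (intro sum.cong) blast+
  moreover have "0 \<le> Re (kernel_form F (\<lambda>f g. \<Sum>i\<in>I. K i f g) a)" for a
    unfolding kernel_form_sum Re_sum using assms unfolding pd_kernel_def by (intro sum_nonneg) blast
  ultimately show ?thesis unfolding pd_kernel_def by blast
qed

section \<open>Schur complements and the Schur product theorem\<close>

lemma kernel_form_insert: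
  assumes "finite F" "x \<notin> F" and herm: "\<And>f. f \<in> F \<Longrightarrow> K f x = cnj (K x f)"
  shows "kernel_form (insert x F) K a
    = cnj (a x) * a x * K x x
      + (cnj (a x) * (\<Sum>g\<in>F. a g * K x g) + a x * cnj (\<Sum>g\<in>F. a g * K x g))
      + kernel_form F K a"
  using assms
  by (simp add: kernel_form_def sum.distrib sum_distrib_left mult_ac)

lemma pd_kernel_diag:
  assumes "pd_kernel F K" "x \<in> F" "finite F"
  shows "K x x = complex_of_real (Re (K x x))" "0 \<le> Re (K x x)"
proof -
  have "Im (K x x) = Im (cnj (K x x))"
    by (rule arg_cong[OF pd_kernel_hermitian[OF assms(1,2,2)]])
  then show "K x x = complex_of_real (Re (K x x))"
    by (simp add: complex_eq_iff)
  have "kernel_form F K (\<lambda>f. if f = x then 1 else 0)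
      = (\<Sum>f\<in>F. \<Sum>g\<in>F. if f = x then if g = x then K f g else 0 else 0)"
    unfolding kernel_form_def by (intro sum.cong) auto
  also have "\<dots> = (\<Sum>f\<in>F. if f = x then K f x else 0)"
    using assms by (intro sum.cong) auto
  also have "\<dots> = K x x"
    using assms by simp
  finally show "0 \<le> Re (K x x)"
    using pd_kernel_form[OF assms(1), of "\<lambda>f. if f = x then 1 else 0"] by simp
qed

text \<open>If \<open>K x x = 0\<close>, positivity on \<open>{x, f}\<close> forces the whole row \<open>K x f\<close> to vanish, so the
  Schur complement below is meaningful with \<open>1 / 0 = 0\<close>.\<close>

lemma pd_kernel_row_zero:
  assumes pd: "pd_kernel F K" and F: "finite F" "x \<in> F" "f \<in> F" and 0: "K x x = 0"
  shows "K x f = 0"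
proof (rule ccontr)
  assume n: "K x f \<noteq> 0"
  then have "f \<noteq> x" using 0 by auto
  \<comment> \<open>With \<open>K x x = 0\<close> the form at \<open>a\<close> equals
    \<open>K f f\<close> minus twice \<open>s * (cmod (K x f))\<^sup>2\<close>; this
    \<open>s\<close> makes it \<open>- K f f - 2\<close>, which is negative.\<close>
  define s where "s = (Re (K f f) + 1) / (cmod (K x f))\<^sup>2"
  define a where "a g = (if g = x then - complex_of_real s * K x f else if g = f then 1 else 0)" for g
  have sub: "kernel_form F K a = kernel_form {x, f} K a"
  proof -
    have "(\<Sum>g\<in>F. cnj (a h) * a g * K h g) = (\<Sum>g\<in>{x,f}. cnj (a h) * a g * K h g)" for h
      using F by (intro sum.mono_neutral_right) (auto simp: a_def)
    moreover have "(\<Sum>h\<in>F. \<Sum>g\<in>{x,f}. cnj (a h) * a g * K h g)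
        = (\<Sum>h\<in>{x,f}. \<Sum>g\<in>{x,f}. cnj (a h) * a g * K h g)"
      using F by (intro sum.mono_neutral_right) (auto simp: a_def)
    ultimately show ?thesis by (simp only: kernel_form_def)
  qed
  have h: "K f x = cnj (K x f)" using pd_kernel_hermitian[OF pd] F by blast
  have "kernel_form {x, f} K a
    = cnj (a x) * a x * K x x
      + (cnj (a x) * (\<Sum>g\<in>{f}. a g * K x g) + a x * cnj (\<Sum>g\<in>{f}. a g * K x g))
      + kernel_form {f} K a"
    by (rule kernel_form_insert) (use h \<open>f \<noteq> x\<close> in auto)
  also have "\<dots> = K f f - 2 * (complex_of_real s * (K x f * cnj (K x f)))"
    using \<open>f \<noteq> x\<close> 0 by (simp add: a_def kernel_form_def algebra_simps)
  also have "complex_of_real s * (K x f * cnj (K x f)) = complex_of_real (Re (K f f) + 1)"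
    unfolding complex_norm_square[symmetric] s_def using n by simp
  finally have "Re (kernel_form F K a) = Re (K f f) - 2 * (Re (K f f) + 1)"
    using sub by simp
  moreover have "0 \<le> Re (K f f)" using pd_kernel_diag[OF pd] F by blast
  moreover have "0 \<le> Re (kernel_form F K a)" by (rule pd_kernel_form[OF pd])
  ultimately show False by simp
qed

text \<open>Completing the square: the form of the complement at \<open>a\<close> is the form of
  \<open>K\<close> at \<open>a\<close> extended by the minimizing coefficient at
  \<open>x\<close>.\<close>

lemma pd_kernel_schur_complement:
  assumes pd: "pd_kernel (insert x F) K" and F: "finite F" "x \<notin> F"
  shows "pd_kernel F (\<lambda>f g. K f g - K f x * K x g / K x x)"
proof -
  have herm: "K g f = cnj (K f g)" if "f \<in> insert x F" "g \<in> insert x F" for f g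
    using pd_kernel_hermitian[OF pd] that by blast
  obtain k where k: "K x x = complex_of_real k"
    using pd_kernel_diag(1)[OF pd] F by blast
  have "0 \<le> Re (kernel_form F (\<lambda>f g. K f g - K f x * K x g / K x x) a)" for a
  proof -
    define S where "S = (\<Sum>g\<in>F. a g * K x g)"
    \<comment> \<open>The minimizing coefficient. If \<open>K x x = 0\<close> it is 0 by division by
      zero, and the subtracted kernel vanishes as well.\<close>
    define b where "b = a(x := - S / K x x)"
    have "kernel_form F (\<lambda>f g. K f g - K f x * K x g / K x x) a
        = kernel_form F K a - kernel_form F (\<lambda>f g. inverse (K x x) * (cnj (K x f) * K x g)) a"
      unfolding kernel_form_diff[symmetric]
    proof (rule kernel_form_cong)
      fix f g assume "f \<in> F" "g \<in> F"
      then have "K f x = cnj (K x f)" using herm by blast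
      then show "K f g - K f x * K x g / K x x
          = K f g - inverse (K x x) * (cnj (K x f) * K x g)"
        by (simp add: field_simps)
    qed
    also have "\<dots> = kernel_form F K a - inverse (K x x) * (S * cnj S)"
      unfolding kernel_form_scale kernel_form_one complex_norm_square by (simp add: S_def)
    also have "\<dots> = kernel_form (insert x F) K b"
    proof -
      have Sb: "(\<Sum>g\<in>F. b g * K x g) = S" and Fb: "kernel_form F K b = kernel_form F K a"
        using F by (auto simp: S_def b_def kernel_form_def intro!: sum.cong)
      have "kernel_form (insert x F) K b
          = cnj (b x) * b x * K x x + (cnj (b x) * S + b x * cnj S) + kernel_form F K a"
        using kernel_form_insert[OF F, of K b, unfolded Sb Fb] herm by blast
      moreover have "b x = - S / complex_of_real k" by (simp add: b_def k)
      ultimately show ?thesis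
        by (cases "k = 0") (simp_all add: k field_simps)
    qed
    finally show ?thesis using pd_kernel_form[OF pd] by simp
  qed
  moreover have "K g f - K g x * K x f / K x x = cnj (K f g - K f x * K x g / K x x)"
    if "f \<in> F" "g \<in> F" for f g
  proof -
    have "K g f = cnj (K f g)" "K g x = cnj (K x g)" "K f x = cnj (K x f)"
      using herm that by blast+
    then show ?thesis by (simp add: k)
  qed
  ultimately show ?thesis unfolding pd_kernel_def by blast
qed

text \<open>\<open>L\<close> is its Schur complement \<open>L'\<close> plus a rank-one kernel. The
  rank-one part of the product is a form of \<open>K\<close>; the rest lives on \<open>F\<close>,
  where the induction hypothesis applies.\<close>

lemma schur_product_form:
  assumes "finite F" "pd_kernel F K" "pd_kernel F L"
  shows "0 \<le> Re (kernel_form F (\<lambda>f g. K f g * L f g) a)"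
  using assms
proof (induction F arbitrary: K L a rule: finite_induct)
  case empty
  then show ?case by (simp add: kernel_form_def)
next
  case (insert x F)
  let ?F = "insert x F"
  define L' where "L' f g = L f g - L f x * L x g / L x x" for f g
  have herm: "L f x = cnj (L x f)" if "f \<in> ?F" for f
    using pd_kernel_hermitian[OF insert.prems(2)] that by blast
  have row: "L x f = 0" if "L x x = 0" "f \<in> ?F" for f
    using pd_kernel_row_zero[OF insert.prems(2)] that insert.hyps by auto
  \<comment> \<open>The row and column of \<open>L'\<close> at \<open>x\<close> vanish by
    cancellation, or by \<open>row\<close> if \<open>L x x = 0\<close>.\<close>
  have L'0: "L' x f = 0" "L' f x = 0" if "f \<in> ?F" for f
  proof -
    have "L f x = cnj (L x f)" using herm that by blast
    then show "L' x f = 0" "L' f x = 0"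
      using row[OF _ that] by (cases "L x x = 0"; simp add: L'_def)+
  qed
  obtain k where k: "L x x = complex_of_real k" "0 \<le> k"
    using pd_kernel_diag[OF insert.prems(2), of x] insert.hyps by auto
  have "pd_kernel F K"
  proof -
    have "kernel_form ?F K (a(x := 0)) = kernel_form F K a" for a
      using insert.hyps by (auto simp: kernel_form_def intro!: sum.cong)
    then show ?thesis using insert.prems(1) unfolding pd_kernel_def by (metis insertCI)
  qed
  moreover have "pd_kernel F L'"
    unfolding L'_def by (rule pd_kernel_schur_complement) (use insert in auto)
  ultimately have "0 \<le> Re (kernel_form F (\<lambda>f g. K f g * L' f g) a)"
    by (rule insert.IH)
  also have "kernel_form F (\<lambda>f g. K f g * L' f g) a = kernel_form ?F (\<lambda>f g. K f g * L' f g) a"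
    using insert.hyps L'0 by (simp add: kernel_form_def)
  also have "\<dots> = kernel_form ?F (\<lambda>f g. K f g * L f g) a
      - kernel_form ?F (\<lambda>f g. inverse (L x x) * (K f g * (cnj (L x f) * L x g))) a"
    unfolding kernel_form_diff[symmetric]
  proof (rule kernel_form_cong)
    fix f g assume "f \<in> ?F" "g \<in> ?F"
    then have "L f x = cnj (L x f)" using herm by blast
    then show "K f g * L' f g = K f g * L f g - inverse (L x x) * (K f g * (cnj (L x f) * L x g))"
      by (simp add: L'_def field_simps)
  qed
  also have "kernel_form ?F (\<lambda>f g. inverse (L x x) * (K f g * (cnj (L x f) * L x g))) a
      = inverse k * kernel_form ?F K (\<lambda>f. a f * L x f)"
    unfolding kernel_form_scale kernel_form_rank_one by (simp add: k)
  finally have "Re (inverse k * kernel_form ?F K (\<lambda>f. a f * L x f))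
      \<le> Re (kernel_form ?F (\<lambda>f g. K f g * L f g) a)" by simp
  moreover have "0 \<le> Re (inverse k * kernel_form ?F K (\<lambda>f. a f * L x f))"
    using pd_kernel_form[OF insert.prems(1)] k(2) by (simp flip: of_real_inverse)
  ultimately show ?case by linarith
qed

lemma pd_kernel_mult:
  assumes "finite F" "pd_kernel F K" "pd_kernel F L"
  shows "pd_kernel F (\<lambda>f g. K f g * L f g)"
proof -
  have "K g f * L g f = cnj (K f g * L f g)" if "f \<in> F" "g \<in> F" for f g
  proof -
    have "K g f = cnj (K f g)" "L g f = cnj (L f g)"
      using assms that unfolding pd_kernel_def by blast+
    then show ?thesis by simp
  qed
  then show ?thesis
    using schur_product_form[OF assms] unfolding pd_kernel_def by blast
qed

lemma kernel_form_cinner: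
  "kernel_form F (\<lambda>f g. cinner (v f) (v g :: 'h::complex_hilbert)) a
    = cinner (\<Sum>f\<in>F. a f *\<^sub>C v f) (\<Sum>f\<in>F. a f *\<^sub>C v f)"
  by (simp add: kernel_form_def cinner_sum_left cinner_sum_right cinner_scaleC_left
      cinner_scaleC_right sum_distrib_left mult_ac) (subst sum.swap, rule refl)


section \<open>The algebra of square-integrable, essentially bounded functions\<close>

lemma L2_Linf_cnj_mult_integrable:
  assumes f: "L2_Linf f" and g: "L2_Linf g"
  shows "integrable lborel (\<lambda>s. cnj (f s) * g s)"
proof (rule Bochner_Integration.integrable_bound)
  show "integrable lborel (\<lambda>s. (cmod (f s))\<^sup>2 + (cmod (g s))\<^sup>2)"
    using f g by (auto simp: L2_Linf_def)
  show "(\<lambda>s. cnj (f s) * g s) \<in> borel_measurable lborel"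
    using L2_Linf_mult[OF L2_Linf_cnj[OF f] g] by (simp add: L2_Linf_def)
  show "AE s in lborel. norm (cnj (f s) * g s) \<le> norm ((cmod (f s))\<^sup>2 + (cmod (g s))\<^sup>2)"
  proof (rule AE_I2)
    fix s
    have "0 \<le> cmod (f s) * cmod (g s)" by simp
    then have "cmod (f s) * cmod (g s) \<le> (cmod (f s))\<^sup>2 + (cmod (g s))\<^sup>2"
      using sum_squares_bound[of "cmod (f s)" "cmod (g s)"] by linarith
    then show "norm (cnj (f s) * g s) \<le> norm ((cmod (f s))\<^sup>2 + (cmod (g s))\<^sup>2)"
      by (simp add: norm_mult)
  qed
qed

lemma inner_sqb_add_right: "inner_sqb f (g + h) = inner_sqb f g + inner_sqb f h"
  by transfer
    (simp add: L2_Linf_eq_def distrib_left L2_Linf_cnj_mult_integrable)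

lemma inner_sqb_scale_right: "inner_sqb f (a *\<^sub>C g) = a * inner_sqb f g"
  by transfer (simp add: mult.left_commute)

lemma inner_sqb_commute: "inner_sqb g f = cnj (inner_sqb f g)"
  by transfer (simp add: mult.commute flip: Bochner_Integration.integral_cnj)

lemma inner_sqb_self: "inner_sqb f f = complex_of_real ((norm2_sqb f)\<^sup>2)"
  by transfer
    (simp add: mult.commute flip: complex_norm_square of_real_power integral_complex_of_real)

lemma inner_sqb_mult_left: "inner_sqb (f * g) h = inner_sqb g (conj_sqb f * h)"
  by transfer (simp add: mult_ac)

lemma inner_sqb_add_left: "inner_sqb (f + g) h = inner_sqb f h + inner_sqb g h"
  by (metis complex_cnj_add inner_sqb_add_right inner_sqb_commute)

lemma inner_sqb_scale_left: "inner_sqb (a *\<^sub>C f) g = cnj a * inner_sqb f g"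
  by (metis complex_cnj_mult inner_sqb_commute inner_sqb_scale_right)

lemma inner_sqb_zero_right [simp]: "inner_sqb f 0 = 0"
  using inner_sqb_add_right[of f 0 0] by simp

lemma inner_sqb_zero_left [simp]: "inner_sqb 0 f = 0"
  using inner_sqb_add_left[of 0 0 f] by simp

lemma inner_sqb_sum_right: "inner_sqb f (\<Sum>i\<in>I. g i) = (\<Sum>i\<in>I. inner_sqb f (g i))"
  by (induction I rule: infinite_finite_induct) (simp_all add: inner_sqb_add_right)

lemma inner_sqb_sum_left: "inner_sqb (\<Sum>i\<in>I. g i) f = (\<Sum>i\<in>I. inner_sqb (g i) f)"
  by (induction I rule: infinite_finite_induct) (simp_all add: inner_sqb_add_left)

lemma scaleC_mult_sqb: "f * (a *\<^sub>C g) = a *\<^sub>C (f * g :: 'd::finite sqb)"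
  by transfer (auto simp: L2_Linf_eq_def mult_ac
      intro!: L2_Linf_mult L2_Linf_scale[OF L2_Linf_mult, unfolded mult.assoc])

text \<open>\<open>real_of_ereal\<close> sends infinity to 0, so the essential bound of
  \<open>f\<close> is needed to see that the supremum is finite.\<close>

lemma AE_cmod_le_esssup:
  assumes "L2_Linf f"
  shows "AE s in lborel. cmod (f s) \<le> real_of_ereal (esssup lborel (\<lambda>s. ereal (cmod (f s))))"
proof -
  let ?E = "esssup lborel (\<lambda>s. ereal (cmod (f s)))"
  have [measurable]: "f \<in> borel_measurable lborel" using assms by (simp add: L2_Linf_def)
  obtain C where C: "AE s in lborel. cmod (f s) \<le> C" using assms by (auto simp: L2_Linf_def)
  have "?E \<le> ereal C"
    by (rule esssup_I) (use C in auto)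
  then have fin: "?E \<noteq> \<infinity>" by auto
  have "AE s in lborel. ereal (cmod (f s)) \<le> ?E"
    by (rule esssup_AE)
  then show ?thesis
  proof eventually_elim
    case (elim s)
    then show ?case using fin by (cases ?E) auto
  qed
qed

lemma norm2_sqb_mult_le:
  assumes "norm_inf_sqb f \<le> r" "0 \<le> r"
  shows "(norm2_sqb (f * g))\<^sup>2 \<le> r\<^sup>2 * (norm2_sqb g)\<^sup>2"
  using assms
proof transfer
  fix f g :: "real^'a \<Rightarrow> complex" and r :: real
  assume "L2_Linf_eq f f" "L2_Linf_eq g g" and r: "0 \<le> r"
    and le: "real_of_ereal (esssup lborel (\<lambda>s. ereal (cmod (f s)))) \<le> r"
  then have f: "L2_Linf f" and g: "L2_Linf g" by (auto simp: L2_Linf_eq_def)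
  have "AE s in lborel. (cmod (f s * g s))\<^sup>2 \<le> r\<^sup>2 * (cmod (g s))\<^sup>2"
    using AE_cmod_le_esssup[OF f]
  proof eventually_elim
    case (elim s)
    then have "(cmod (f s))\<^sup>2 \<le> r\<^sup>2" using le by (intro power_mono) auto
    then show ?case by (simp add: norm_mult power_mult_distrib mult_right_mono)
  qed
  moreover have "integrable lborel (\<lambda>s. (cmod (f s * g s))\<^sup>2)" "integrable lborel (\<lambda>s. (cmod (g s))\<^sup>2)"
    using L2_Linf_mult[OF f g] g by (auto simp: L2_Linf_def)
  ultimately have "(LINT s|lborel. (cmod (f s * g s))\<^sup>2) \<le> (LINT s|lborel. r\<^sup>2 * (cmod (g s))\<^sup>2)"
    by (intro integral_mono_AE) auto
  then show "(sqrt (LINT s|lborel. (cmod (f s * g s))\<^sup>2))\<^sup>2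
      \<le> r\<^sup>2 * (sqrt (LINT s|lborel. (cmod (g s))\<^sup>2))\<^sup>2"
    by simp
qed

lemma norm2_sqb_nonneg: "0 \<le> norm2_sqb f"
  by transfer simp

text \<open>\<open>'d sqb\<close> has no unit, so powers start at exponent one: \<open>pow_sqb f k\<close> is the power \<open>k + 1\<close>.\<close>

definition pow_sqb :: "'d::finite sqb \<Rightarrow> nat \<Rightarrow> 'd sqb"
  where "pow_sqb f k = (((*) f) ^^ k) f"

lemma pow_sqb_0 [simp]: "pow_sqb f 0 = f"
  and pow_sqb_Suc [simp]: "pow_sqb f (Suc k) = f * pow_sqb f k"
  by (simp_all add: pow_sqb_def)

text \<open>Multiplication by \<open>conj_sqb u\<close> is adjoint to multiplication by
  \<open>u\<close>. This later distributes the powers over the two arguments.\<close>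

lemma inner_sqb_funpow_mult:
  "inner_sqb f ((((*) (conj_sqb u * v)) ^^ k) g) = inner_sqb ((((*) u) ^^ k) f) ((((*) v) ^^ k) g)"
proof (induction k arbitrary: f g)
  case (Suc k)
  have "inner_sqb f ((((*) (conj_sqb u * v)) ^^ Suc k) g)
      = inner_sqb (u * f) ((((*) (conj_sqb u * v)) ^^ k) (v * g))"
  proof -
    have "(((*) (conj_sqb u * v)) ^^ k) (conj_sqb u * v * g)
        = conj_sqb u * (((*) (conj_sqb u * v)) ^^ k) (v * g)"
      by (induction k) (simp_all add: mult_ac)
    then show ?thesis by (simp add: funpow_swap1 inner_sqb_mult_left)
  qed
  also have "\<dots> = inner_sqb ((((*) u) ^^ Suc k) f) ((((*) v) ^^ Suc k) g)"
    unfolding Suc.IH by (simp add: funpow_swap1)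
  finally show ?case .
qed simp

lemma norm2_pow_sqb_le:
  assumes "norm_inf_sqb f \<le> r" "0 \<le> r"
  shows "(norm2_sqb (pow_sqb f k))\<^sup>2 \<le> (r\<^sup>2) ^ k * (norm2_sqb f)\<^sup>2"
proof (induction k)
  case (Suc k)
  have "(norm2_sqb (pow_sqb f (Suc k)))\<^sup>2 \<le> r\<^sup>2 * (norm2_sqb (pow_sqb f k))\<^sup>2"
    by (simp add: norm2_sqb_mult_le assms)
  also have "\<dots> \<le> r\<^sup>2 * ((r\<^sup>2) ^ k * (norm2_sqb f)\<^sup>2)"
    by (intro mult_left_mono Suc) auto
  finally show ?case by (simp add: mult.assoc)
qed simp


section \<open>The Gram kernels of the quadratic Fock space\<close>

locale fock_gns = fock_state c \<omega> + gns_triple c \<omega> \<pi> \<Phi>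
  for c :: real and \<omega> :: "'d::finite free_alg \<Rightarrow> complex"
    and \<pi> :: "'d free_alg \<Rightarrow> 'h::complex_hilbert \<Rightarrow> 'h" and \<Phi> :: 'h
begin

abbreviation dom :: "'h set" where "dom \<equiv> gns_domain \<pi> \<Phi>"

lemma domE: assumes "u \<in> dom" obtains x where "u = \<pi> x \<Phi>"
  using assms by (auto simp: gns_domain_def)

lemma dom_I [simp, intro]: "\<pi> x \<Phi> \<in> dom"
  by (simp add: gns_domain_def)

lemma dom_vacuum [simp, intro]: "\<Phi> \<in> dom"
  using dom_I[of 1] by (simp only: vacuum)

lemma dom_op [simp, intro]: "u \<in> dom \<Longrightarrow> \<pi> x u \<in> dom"
  by (erule domE) (simp flip: rep_mult)

lemma dom_scale [simp, intro]: "u \<in> dom \<Longrightarrow> a *\<^sub>C u \<in> dom"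
  by (elim domE) (simp flip: rep_scale)

lemma op_zero: "\<pi> x 0 = 0"
  using op_scale[of \<Phi> x 0] by simp

lemma rep_diff: "u \<in> dom \<Longrightarrow> \<pi> (x - y) u = \<pi> x u - \<pi> y u"
  using rep_add[of u "x - y" y] by (simp add: eq_diff_eq)

lemma rep_one: "u \<in> dom \<Longrightarrow> \<pi> 1 u = u"
  by (erule domE) (simp flip: rep_mult)

text \<open>The squared norm is the Fock state of a product ending in \<open>Bm f\<close>, hence
  0.\<close>

lemma Bm_vacuum: "\<pi> (Bm f) \<Phi> = 0"
proof -
  have "cinner (\<pi> (Bm f) \<Phi>) (\<pi> (Bm f) \<Phi>) = \<omega> (star (Bm f) * Bm f)"
    by (simp add: rep_star rep_mult vector_state)
  then show ?thesis by (simp add: Bm cinner_self)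
qed

lemma Nn_vacuum: "\<pi> (Nn f) \<Phi> = 0"
proof -
  have "cinner (\<pi> (Nn f) \<Phi>) (\<pi> (Nn f) \<Phi>) = \<omega> (star (Nn f) * Nn f)"
    by (simp add: rep_star rep_mult vector_state)
  then show ?thesis by (simp add: Nn cinner_self)
qed

lemma norm_vacuum: "norm \<Phi> = 1"
proof -
  have "cinner \<Phi> \<Phi> = 1" using vector_state[of 1] by (simp add: vacuum one)
  then show ?thesis by (simp add: norm_eq_sqrt_cinner)
qed

section \<open>Action of the generators on the levels\<close>

lemma rep_relator:
  assumes "x - y \<in> relators c" "u \<in> dom"
  shows "\<pi> x u = \<pi> y u"
  using rep_vanishes[OF assms(2) rswn_ideal.rel[OF assms(1)]] assms(2) by (simp add: rep_diff)

lemma Bm_Bp: "u \<in> dom \<Longrightarrow> \<pi> (Bm f) (\<pi> (Bp g) u) = \<pi> (Bp g) (\<pi> (Bm f) u)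
    + (2 * complex_of_real c * inner_sqb f g) *\<^sub>C u + 4 *\<^sub>C \<pi> (Nn (conj_sqb f * g)) u"
  using rep_relator[OF relators.B_Bp, of u f g]
  by (simp add: rep_diff rep_mult rep_add rep_scale rep_one algebra_simps)

lemma Nn_Bp: "u \<in> dom \<Longrightarrow> \<pi> (Nn f) (\<pi> (Bp g) u) = \<pi> (Bp g) (\<pi> (Nn f) u) + 2 *\<^sub>C \<pi> (Bp (f * g)) u"
  using rep_relator[OF relators.N_Bp, of u f g]
  by (simp add: rep_diff rep_mult rep_scale algebra_simps)

lemma Bp_commute: "u \<in> dom \<Longrightarrow> \<pi> (Bp f) (\<pi> (Bp g) u) = \<pi> (Bp g) (\<pi> (Bp f) u)"
  using rep_vanishes[OF _ rswn_ideal.rel[OF relators.Bp_Bp], of u f g]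
  by (simp add: rep_diff rep_mult)

lemma cinner_Bp_right:
  "u \<in> dom \<Longrightarrow> v \<in> dom \<Longrightarrow> cinner u (\<pi> (Bp f) v) = cinner (\<pi> (Bm f) u) v"
  by (simp add: rep_star star_gen_eq)

abbreviation \<psi> :: "'d sqb \<Rightarrow> nat \<Rightarrow> 'h" where "\<psi> \<equiv> qexp_term \<pi> \<Phi>"

lemma psi_0 [simp]: "\<psi> f 0 = \<Phi>"
  by (simp add: qexp_term_def)

lemma funpow_dom: "((\<pi> (Bp f)) ^^ n) \<Phi> \<in> dom"
  by (induction n) auto

lemma psi_dom [simp, intro]: "\<psi> f n \<in> dom"
  unfolding qexp_term_def by (intro dom_scale funpow_dom)

lemma Bp_psi: "\<pi> (Bp f) (\<psi> f n) = of_nat (Suc n) *\<^sub>C \<psi> f (Suc n)"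
  unfolding qexp_term_def
  by (simp add: op_scale[OF funpow_dom] scaleC_scaleC del: of_nat_Suc)

lemma psi_Suc: "\<psi> f (Suc n) = (1 / of_nat (Suc n)) *\<^sub>C \<pi> (Bp f) (\<psi> f n)"
  unfolding Bp_psi scaleC_scaleC by (simp del: of_nat_Suc)

text \<open>\<open>Nn h\<close> kills the vacuum and acts as a derivation on products of creation
  operators; the number of factors cancels against the factorial.\<close>

lemma Nn_psi: "\<pi> (Nn h) (\<psi> f (Suc n)) = 2 *\<^sub>C \<pi> (Bp (h * f)) (\<psi> f n)"
proof (induction n)
  case 0
  then show ?case by (simp add: psi_Suc Nn_Bp Nn_vacuum op_zero scaleC_one)
next
  case (Suc n)
  let ?s = "of_nat (Suc (Suc n)) :: complex"
  \<comment> \<open>Scaling by the level number turns the top vector into \<open>Bp f\<close>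
    applied to the level below; the scalar is cancelled at the end.\<close>
  have "?s *\<^sub>C \<pi> (Nn h) (\<psi> f (Suc (Suc n))) = \<pi> (Nn h) (\<pi> (Bp f) (\<psi> f (Suc n)))"
    by (simp only: Bp_psi op_scale[OF psi_dom])
  also have "\<dots> = 2 *\<^sub>C \<pi> (Bp (h * f)) (\<pi> (Bp f) (\<psi> f n)) + 2 *\<^sub>C \<pi> (Bp (h * f)) (\<psi> f (Suc n))"
    by (simp add: Nn_Bp Suc.IH op_scale Bp_commute)
  also have "\<dots> = ?s *\<^sub>C (2 *\<^sub>C \<pi> (Bp (h * f)) (\<psi> f (Suc n)))"
    unfolding Bp_psi op_scale[OF psi_dom] scaleC_scaleC scaleC_add_left[symmetric]
    by (simp add: algebra_simps)
  finally show ?case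
    by (metis cvec.scale_left_imp_eq of_nat_neq_0)
qed

text \<open>The normalization \<open>1 / n!\<close> of \<open>\<psi>\<close> removes all combinatorial factors on the right-hand side.\<close>

lemma Bm_psi_1: "\<pi> (Bm h) (\<psi> f (Suc 0)) = (2 * complex_of_real c * inner_sqb h f) *\<^sub>C \<psi> f 0"
  by (simp add: psi_Suc Bm_Bp Bm_vacuum Nn_vacuum op_zero scaleC_one)

text \<open>Moving \<open>Bm h\<close> past each \<open>Bp f\<close> leaves a central term and a
  number operator, which \<open>Nn_psi\<close> evaluates on the remaining factors.\<close>

lemma Bm_psi: "\<pi> (Bm h) (\<psi> f (Suc (Suc n)))
    = (2 * complex_of_real c * inner_sqb h f) *\<^sub>C \<psi> f (Suc n)
      + 4 *\<^sub>C \<pi> (Bp (conj_sqb h * f * f)) (\<psi> f n)"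
proof (induction n)
  let ?k = "2 * complex_of_real c * inner_sqb h f"
  case 0
  have "2 *\<^sub>C \<pi> (Bm h) (\<psi> f (Suc (Suc 0))) = \<pi> (Bm h) (\<pi> (Bp f) (\<psi> f (Suc 0)))"
    by (simp add: Bp_psi op_scale)
  also have "\<dots> = ?k *\<^sub>C (\<pi> (Bp f) (\<psi> f 0) + \<psi> f (Suc 0))
      + 8 *\<^sub>C \<pi> (Bp (conj_sqb h * f * f)) (\<psi> f 0)"
    by (simp add: Bm_Bp Nn_psi Bm_psi_1 op_scale scaleC_add_right scaleC_scaleC)
  also have "\<dots> = 2 *\<^sub>C (?k *\<^sub>C \<psi> f (Suc 0) + 4 *\<^sub>C \<pi> (Bp (conj_sqb h * f * f)) (\<psi> f 0))"
    unfolding Bp_psi by (simp add: scaleC_add_right scaleC_scaleC scaleC_one mult_ac flip: scaleC_add_left)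
  finally show ?case
    by (metis cvec.scale_left_imp_eq zero_neq_numeral)
next
  case (Suc n)
  let ?k = "2 * complex_of_real c * inner_sqb h f"
  let ?s = "of_nat (Suc (Suc (Suc n))) :: complex"
  let ?B = "\<pi> (Bp (conj_sqb h * f * f))"
  have "?s *\<^sub>C \<pi> (Bm h) (\<psi> f (Suc (Suc (Suc n)))) = \<pi> (Bm h) (\<pi> (Bp f) (\<psi> f (Suc (Suc n))))"
    by (simp only: Bp_psi op_scale[OF psi_dom])
  also have "\<dots> = ?k *\<^sub>C \<pi> (Bp f) (\<psi> f (Suc n)) + 4 *\<^sub>C ?B (\<pi> (Bp f) (\<psi> f n))
      + ?k *\<^sub>C \<psi> f (Suc (Suc n)) + 8 *\<^sub>C ?B (\<psi> f (Suc n))"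
    by (simp add: Bm_Bp Nn_psi Suc.IH op_scale op_add Bp_commute[of _ f] scaleC_scaleC)
  also have "\<dots> = (?k * of_nat (Suc (Suc n)) + ?k) *\<^sub>C \<psi> f (Suc (Suc n))
      + (4 * of_nat (Suc n) + 8) *\<^sub>C ?B (\<psi> f (Suc n))"
    unfolding Bp_psi op_scale[OF psi_dom] scaleC_scaleC scaleC_add_left by (simp add: add_ac)
  also have "\<dots> = ?s *\<^sub>C (?k *\<^sub>C \<psi> f (Suc (Suc n)) + 4 *\<^sub>C ?B (\<psi> f (Suc n)))"
    unfolding scaleC_add_right scaleC_scaleC
    by (intro arg_cong2[of _ _ _ _ plus] arg_cong2[of _ _ _ _ scaleC] refl) (simp_all add: algebra_simps)
  finally show ?case
    by (metis cvec.scale_left_imp_eq of_nat_neq_0)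
qed

section \<open>Orthogonality of the levels and the recursion for the Gram kernels\<close>

lemma cinner_psi_Suc:
  "cinner u (\<psi> g (Suc n)) = cinner u (\<pi> (Bp g) (\<psi> g n)) / of_nat (Suc n)"
  by (simp add: psi_Suc cinner_scaleC_right)

lemma cinner_vacuum_Bp: "u \<in> dom \<Longrightarrow> cinner \<Phi> (\<pi> (Bp g) u) = 0"
  by (simp add: cinner_Bp_right Bm_vacuum)

lemma cinner_psi_1_Bp:
  "u \<in> dom \<Longrightarrow> cinner (\<psi> f (Suc 0)) (\<pi> (Bp h) u) = 2 * complex_of_real c * inner_sqb f h * cinner \<Phi> u"
  by (simp add: cinner_Bp_right Bm_psi_1 cinner_scaleC_left flip: inner_sqb_commute)

text \<open>The creation operator crosses to the left as \<open>Bm h\<close>, where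
  \<open>Bm_psi\<close> turns it into a new creation operator on a vector two levels lower.
  Conjugation restores the original shape with the arguments exchanged.\<close>

lemma cinner_psi_Bp:
  "u \<in> dom \<Longrightarrow> cinner (\<psi> f (Suc (Suc n))) (\<pi> (Bp h) u)
    = 2 * complex_of_real c * inner_sqb f h * cinner (\<psi> f (Suc n)) u
      + 4 * cnj (cinner u (\<pi> (Bp (conj_sqb h * f * f)) (\<psi> f n)))"
  by (simp add: cinner_Bp_right Bm_psi cinner_add_left cinner_scaleC_left
      flip: inner_sqb_commute cinner_commute)
    (simp add: rep_star star_gen_eq)

text \<open>The creation operator must be arbitrary: \<open>cinner_psi_Bp\<close> replaces
  \<open>h\<close> by \<open>conj_sqb h * f * f\<close> even when starting from
  \<open>h = g\<close>. Each use lowers \<open>n + m\<close>.\<close>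

lemma psi_Bp_orthogonal: "n \<noteq> Suc m \<Longrightarrow> cinner (\<psi> f n) (\<pi> (Bp h) (\<psi> g m)) = 0"
proof (induction "n + m" arbitrary: n m f h g rule: less_induct)
  case less
  show ?case
  proof (cases n rule: nat.exhaust[case_names 0 Suc])
    case 0
    then show ?thesis by (simp add: cinner_vacuum_Bp)
  next
    case (Suc k)
    \<comment> \<open>For \<open>m > 0\<close>, \<open>\<psi> g m\<close> is itself a multiple of
      \<open>Bp g\<close> applied to a lower level, so the induction hypothesis applies.\<close>
    have p: "cinner (\<psi> f k) (\<psi> g m) = 0"
    proof (cases m)
      case 0
      then have "cinner \<Phi> (\<psi> f k) = 0"
        using less.prems Suc by (cases k) (simp_all add: cinner_psi_Suc cinner_vacuum_Bp)
      then show ?thesis using 0 cinner_commute[of "\<psi> f k" \<Phi>] by simp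
    next
      case (Suc l)
      then show ?thesis
        using less.hyps[of k l f g g] less.prems \<open>n = Suc k\<close> by (simp add: cinner_psi_Suc)
    qed
    show ?thesis
    proof (cases k)
      case 0
      then show ?thesis using p \<open>n = Suc k\<close> by (simp add: cinner_psi_1_Bp)
    next
      case (Suc j)
      then show ?thesis
        using p less.hyps[of m j g "conj_sqb h * f * f" f] less.prems \<open>n = Suc k\<close>
        by (simp add: cinner_psi_Bp)
    qed
  qed
qed

lemma psi_orthogonal:
  assumes "m \<noteq> n" shows "cinner (\<psi> f m) (\<psi> g n) = 0"
proof (cases n)
  case 0
  then show ?thesis
    using assms cinner_commute[of "\<psi> f m" \<Phi>]
    by (cases m) (simp_all add: cinner_psi_Suc cinner_vacuum_Bp)
next
  case (Suc k)
  then show ?thesis using assms by (simp add: cinner_psi_Suc psi_Bp_orthogonal)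
qed

definition level_kernel :: "nat \<Rightarrow> 'd sqb \<Rightarrow> 'd sqb \<Rightarrow> complex"
  where "level_kernel n f g = cinner (\<psi> f n) (\<psi> g n)"

lemma level_kernel_0: "level_kernel 0 f g = 1"
  by (simp add: level_kernel_def cinner_self norm_vacuum)

lemma level_kernel_commute: "level_kernel n g f = cnj (level_kernel n f g)"
  unfolding level_kernel_def by (rule cinner_commute)

text \<open>\<open>cinner_psi_Bp\<close> iterated: one application gives the summand
  \<open>k = 0\<close>, and the induction hypothesis with \<open>f\<close> and \<open>g\<close>
  exchanged gives the others.\<close>

lemma cinner_psi_Suc_Bp:
  "cinner (\<psi> f (Suc n)) (\<pi> (Bp h) (\<psi> g n))
    = (\<Sum>k\<le>n. complex_of_real (2 * c * 4 ^ k) * inner_sqb f ((((*) (conj_sqb f * g)) ^^ k) h)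
        * level_kernel (n - k) f g)"
proof (induction n arbitrary: f g h)
  case 0
  then show ?case by (simp add: cinner_psi_1_Bp level_kernel_def)
next
  case (Suc n)
  let ?r = "\<lambda>k. ((*) (conj_sqb f * g)) ^^ k"
  let ?l = "\<lambda>k. ((*) (conj_sqb g * f)) ^^ k"
  \<comment> \<open>Both sides are the integral of
    \<open>cnj f * (cnj f * g)^(k+1) * h\<close>.\<close>
  have shift: "cnj (inner_sqb g (?l k (conj_sqb h * f * f))) = inner_sqb f (?r (Suc k) h)" for k
  proof -
    have "cnj (inner_sqb g (?l k (conj_sqb h * f * f)))
        = cnj (inner_sqb (((*) g ^^ k) g) (((*) f ^^ k) (conj_sqb h * f * f)))"
      by (simp add: inner_sqb_funpow_mult)
    also have "((*) f ^^ k) (conj_sqb h * f * f) = conj_sqb h * (((*) f ^^ Suc k) f)"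
      by (induction k) (simp_all add: mult_ac)
    also have "inner_sqb (((*) g ^^ k) g) (conj_sqb h * (((*) f ^^ Suc k) f))
        = inner_sqb (h * ((*) g ^^ k) g) (((*) f ^^ Suc k) f)"
      by (simp only: inner_sqb_mult_left)
    also have "h * ((*) g ^^ k) g = ((*) g ^^ Suc k) h"
      by (induction k) (simp_all add: mult_ac)
    finally show ?thesis
      by (simp only: inner_sqb_funpow_mult flip: inner_sqb_commute)
  qed
  have "cinner (\<psi> f (Suc (Suc n))) (\<pi> (Bp h) (\<psi> g (Suc n)))
      = 2 * complex_of_real c * inner_sqb f h * level_kernel (Suc n) f g
        + 4 * cnj (cinner (\<psi> g (Suc n)) (\<pi> (Bp (conj_sqb h * f * f)) (\<psi> f n)))"
    by (simp add: cinner_psi_Bp level_kernel_def)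
  also have "cnj (cinner (\<psi> g (Suc n)) (\<pi> (Bp (conj_sqb h * f * f)) (\<psi> f n)))
      = (\<Sum>k\<le>n. complex_of_real (2 * c * 4 ^ k) * inner_sqb f (?r (Suc k) h)
        * level_kernel (n - k) f g)"
    unfolding Suc.IH cnj_sum complex_cnj_mult shift complex_cnj_complex_of_real
      level_kernel_commute[symmetric] ..
  finally show ?case
    unfolding sum.atMost_Suc_shift by (simp add: sum_distrib_left mult_ac)
qed

lemma level_kernel_Suc:
  "level_kernel (Suc n) f g
    = (\<Sum>k\<le>n. complex_of_real (2 * c * 4 ^ k / real (Suc n))
        * (inner_sqb (pow_sqb f k) (pow_sqb g k) * level_kernel (n - k) f g))"
  unfolding level_kernel_def cinner_psi_Suc
  unfolding level_kernel_def[symmetric] cinner_psi_Suc_Bp inner_sqb_funpow_mult pow_sqb_def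
  by (simp add: sum_divide_distrib mult_ac)

end


section \<open>Second quantization\<close>

lemma sums_scaleC: "f sums (s::'h::complex_hilbert) \<Longrightarrow> (\<lambda>n. a *\<^sub>C f n) sums (a *\<^sub>C s)"
  unfolding sums_def by (drule tendsto_scaleC[where a = a]) (simp add: cvec.scale_sum_right)

lemma kernel_form_inner_sqb:
  "kernel_form F (\<lambda>f g. inner_sqb (v f) (v g)) a
    = complex_of_real ((norm2_sqb (\<Sum>f\<in>F. a f *\<^sub>C v f))\<^sup>2)"
  unfolding inner_sqb_self[symmetric]
  by (simp add: kernel_form_def inner_sqb_sum_left inner_sqb_sum_right inner_sqb_scale_left
      inner_sqb_scale_right sum_distrib_left mult_ac) (subst sum.swap, rule refl)

text \<open>A convolution inequality of the type satisfied by the coefficients of \<open>(1 - \<rho> t) powr (- \<beta>)\<close>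
  forces geometric decay at any rate larger than \<open>\<rho>\<close>.\<close>

lemma summable_sqrt_of_convolution_bound:
  fixes a :: "nat \<Rightarrow> real"
  assumes nonneg: "\<And>n. 0 \<le> a n" and \<rho>: "0 \<le> \<rho>" "\<rho> < 1" and \<beta>: "0 \<le> \<beta>"
    and bound: "\<And>n. a (Suc n) \<le> \<beta> / real (Suc n) * (\<Sum>k\<le>n. \<rho> ^ k * a (n - k))"
  shows "summable (\<lambda>n. sqrt (a n))"
proof -
  \<comment> \<open>The convolution \<open>s\<close> obeys a first-order recursion suited to the
    ratio test, and \<open>a (Suc n)\<close> is at most \<open>\<beta> * s n\<close>.\<close>
  define s where "s n = (\<Sum>k\<le>n. \<rho> ^ k * a (n - k))" for n
  \<comment> \<open>Any ratio strictly between \<rho> and 1 would do, since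
    \<open>\<beta> / real (Suc n)\<close> tends to 0.\<close>
  define \<sigma> where "\<sigma> = (\<rho> + 1) / 2"
  have \<sigma>: "\<rho> < \<sigma>" "\<sigma> < 1" "0 \<le> \<sigma>" using \<rho> by (auto simp: \<sigma>_def)
  have s0: "0 \<le> s n" for n
    unfolding s_def using nonneg \<rho> by (intro sum_nonneg mult_nonneg_nonneg) auto
  have step: "s (Suc n) \<le> (\<beta> / real (Suc n) + \<rho>) * s n" for n
  proof -
    have "s (Suc n) = a (Suc n) + \<rho> * s n"
      unfolding s_def sum.atMost_Suc_shift by (simp add: sum_distrib_left mult_ac)
    then show ?thesis using bound[of n] by (simp add: s_def algebra_simps)
  qed
  have "(\<lambda>n. \<beta> / real (Suc n) + \<rho>) \<longlonglongrightarrow> 0 + \<rho>"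
    by (intro tendsto_add LIMSEQ_Suc[OF lim_const_over_n] tendsto_const)
  then have "eventually (\<lambda>n. \<beta> / real (Suc n) + \<rho> < \<sigma>) sequentially"
    using \<sigma> by (intro order_tendstoD) auto
  then obtain N where N: "\<And>n. n \<ge> N \<Longrightarrow> \<beta> / real (Suc n) + \<rho> < \<sigma>"
    by (auto simp: eventually_sequentially)
  have "summable (\<lambda>n. sqrt (s n))"
  proof (rule summable_ratio_test)
    show "sqrt \<sigma> < 1" using \<sigma> by simp
    fix n assume "n \<ge> N"
    then have "s (Suc n) \<le> \<sigma> * s n"
      using step[of n] mult_right_mono[OF less_imp_le[OF N] s0] order_trans by blast
    then show "norm (sqrt (s (Suc n))) \<le> sqrt \<sigma> * norm (sqrt (s n))"
      using s0 by (simp flip: real_sqrt_mult)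
  qed
  then have "summable (\<lambda>n. sqrt \<beta> * sqrt (s n))"
    by (rule summable_mult)
  then have "summable (\<lambda>n. sqrt (a (Suc n)))"
  proof (rule summable_comparison_test'[where N = 0])
    fix n
    have "a (Suc n) \<le> \<beta> / real (Suc n) * s n" using bound by (simp add: s_def)
    also have "\<dots> \<le> \<beta> * s n"
      using \<beta> s0 by (intro mult_right_mono) (auto simp: divide_simps mult_le_cancel_left1)
    finally show "norm (sqrt (a (Suc n))) \<le> sqrt \<beta> * sqrt (s n)"
      using nonneg by (simp flip: real_sqrt_mult)
  qed
  then show ?thesis by (rule summable_Suc_iff[THEN iffD1])
qed

text \<open>On the diagonal the kernel recursion is a convolution bound with ratio
  \<open>4 * r\<^sup>2\<close>, which is below 1 because \<open>r < 1/2\<close>; the series even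
  converges absolutely.\<close>

lemma (in fock_gns) qexp_exists:
  assumes "0 < c" "norm_inf_sqb f < 1/2"
  shows "qexp_exists \<pi> \<Phi> f"
proof -
  \<comment> \<open>The maximum supplies \<open>0 \<le> r\<close> without a proof that
    \<open>norm_inf_sqb f\<close> is nonnegative.\<close>
  define r where "r = max 0 (norm_inf_sqb f)"
  have r: "norm_inf_sqb f \<le> r" "0 \<le> r" "r < 1/2" using assms by (auto simp: r_def)
  have "r\<^sup>2 < (1/2)\<^sup>2" using r by (intro power_strict_mono) auto
  then have \<rho>: "4 * r\<^sup>2 < 1" by (simp add: power2_eq_square)
  have "summable (\<lambda>n. sqrt ((norm (\<psi> f n))\<^sup>2))"
  proof (rule summable_sqrt_of_convolution_bound[where \<rho> = "4 * r\<^sup>2" and \<beta> = "2 * c * (norm2_sqb f)\<^sup>2"])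
    fix n
    have "complex_of_real ((norm (\<psi> f (Suc n)))\<^sup>2) = complex_of_real
        (\<Sum>k\<le>n. 2 * c * 4 ^ k / real (Suc n) * ((norm2_sqb (pow_sqb f k))\<^sup>2 * (norm (\<psi> f (n - k)))\<^sup>2))"
      using level_kernel_Suc[of n f f]
      unfolding level_kernel_def cinner_self inner_sqb_self by simp
    then have "(norm (\<psi> f (Suc n)))\<^sup>2
        = (\<Sum>k\<le>n. 2 * c * 4 ^ k / real (Suc n) * ((norm2_sqb (pow_sqb f k))\<^sup>2 * (norm (\<psi> f (n - k)))\<^sup>2))"
      using of_real_eq_iff by blast
    also have "\<dots> \<le> (\<Sum>k\<le>n. 2 * c * 4 ^ k / real (Suc n)
        * (((r\<^sup>2) ^ k * (norm2_sqb f)\<^sup>2) * (norm (\<psi> f (n - k)))\<^sup>2))"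
      using norm2_pow_sqb_le[OF r(1,2)] assms(1)
      by (intro sum_mono mult_left_mono mult_right_mono) auto
    also have "\<dots> = 2 * c * (norm2_sqb f)\<^sup>2 / real (Suc n)
        * (\<Sum>k\<le>n. (4 * r\<^sup>2) ^ k * (norm (\<psi> f (n - k)))\<^sup>2)"
      unfolding sum_distrib_left by (intro sum.cong refl) (simp add: power_mult_distrib)
    finally show "(norm (\<psi> f (Suc n)))\<^sup>2 \<le> \<dots>" .
  qed (use \<rho> assms(1) in auto)
  then have "summable (\<lambda>n. norm (\<psi> f n))" by simp
  then show ?thesis unfolding qexp_exists_def by (rule summable_norm_cancel)
qed

lemma Gamma2_I:
  assumes "finite F" "\<And>f. f \<in> F \<Longrightarrow> norm_inf_sqb f < 1/2"
  shows "(\<Sum>f\<in>F. a f *\<^sub>C qexp \<pi> \<Phi> f, \<Sum>f\<in>F. a f *\<^sub>C qexp \<pi> \<Phi> (T f)) \<in> Gamma2 \<pi> \<Phi> T"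
  unfolding Gamma2_def using assms by blast

lemma Gamma2_E:
  assumes "(x, y) \<in> Gamma2 \<pi> \<Phi> T"
  obtains F a where "finite F" "\<And>f. f \<in> F \<Longrightarrow> norm_inf_sqb f < 1/2"
    "x = (\<Sum>f\<in>F. a f *\<^sub>C qexp \<pi> \<Phi> f)" "y = (\<Sum>f\<in>F. a f *\<^sub>C qexp \<pi> \<Phi> (T f))"
  using assms unfolding Gamma2_def by blast

section \<open>Contractivity on each level\<close>

locale second_quantization = fock_gns c \<omega> \<pi> \<Phi>
  for c :: real and \<omega> :: "'d::finite free_alg \<Rightarrow> complex"
    and \<pi> :: "'d free_alg \<Rightarrow> 'h::complex_hilbert \<Rightarrow> 'h" and \<Phi> :: 'h +
  fixes \<phi> :: "'d sqb" and T\<^sub>1 T :: "'d sqb \<Rightarrow> 'd sqb"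
  assumes c_pos: "c > 0"
    and multiplier: "norm_inf_sqb \<phi> \<le> 1"
    and T1_linear: "clinear T\<^sub>1"
    and T1_mult: "T\<^sub>1 (f * g) = T\<^sub>1 f * T\<^sub>1 g"
    and T_def: "T f = \<phi> * T\<^sub>1 f"
    and T_norm2: "norm2_sqb (T f) \<le> norm2_sqb f"
    and T_norm_inf: "norm_inf_sqb (T f) \<le> norm_inf_sqb f"
begin

text \<open>The linear map carrying powers of \<open>f\<close> to powers of \<open>T f\<close>.
  Iterated multiplication stands in for \<phi> to the power \<open>k\<close>, as
  \<open>k = 0\<close> would require a unit.\<close>

definition T_pow :: "nat \<Rightarrow> 'd sqb \<Rightarrow> 'd sqb"
  where "T_pow k h = (((*) \<phi>) ^^ k) (T h)"

lemma T_pow_0: "T_pow 0 h = T h" and T_pow_Suc: "T_pow (Suc k) h = \<phi> * T_pow k h"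
  by (simp_all add: T_pow_def)

lemma T_pow_add: "T_pow k (f + g) = T_pow k f + T_pow k g"
  using T1_linear by (induction k) (simp_all add: T_pow_0 T_pow_Suc T_def clinear_iff distrib_left)

lemma T_pow_scale: "T_pow k (a *\<^sub>C f) = a *\<^sub>C T_pow k f"
  using T1_linear by (induction k) (simp_all add: T_pow_0 T_pow_Suc T_def clinear_iff scaleC_mult_sqb)

lemma T_pow_sum: "finite F \<Longrightarrow> T_pow k (\<Sum>f\<in>F. v f) = (\<Sum>f\<in>F. T_pow k (v f))"
proof (induction F rule: finite_induct)
  case empty
  then show ?case using T_pow_add[of k 0 0] by simp
qed (simp add: T_pow_add)

text \<open>Multiplicativity of \<open>T\<^sub>1\<close> gives
  \<open>T f * T h = \<phi> * T (f * h)\<close>, so each further factor \<open>T f\<close>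
  contributes one \<phi>.\<close>

lemma pow_sqb_T: "pow_sqb (T f) k = T_pow k (pow_sqb f k)"
proof (induction k)
  case (Suc k)
  have "T f * T_pow k h = \<phi> * T_pow k (f * h)" for h
  proof (induction k)
    case 0
    show ?case unfolding T_pow_0 unfolding T_def T1_mult by (simp only: mult_ac)
  next
    case (Suc k)
    then show ?case by (simp only: T_pow_Suc mult.left_commute[of "T f"])
  qed
  then show ?case by (simp add: Suc T_pow_Suc)
qed (simp add: T_pow_0)

lemma norm2_T_pow_le: "(norm2_sqb (T_pow k h))\<^sup>2 \<le> (norm2_sqb h)\<^sup>2"
proof (induction k)
  case 0
  then show ?case by (simp add: T_pow_0 T_norm2 norm2_sqb_nonneg power_mono)
next
  case (Suc k)
  then show ?case
    using norm2_sqb_mult_le[OF multiplier, of "T_pow k h"] by (simp add: T_pow_Suc)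
qed

lemma pd_inner_pow:
  "pd_kernel F (\<lambda>f g. inner_sqb (pow_sqb (T f) k) (pow_sqb (T g) k))"
  unfolding pd_kernel_def kernel_form_inner_sqb
  by (simp flip: inner_sqb_commute)

text \<open>By linearity of \<open>T_pow k\<close> the form is the squared norm of a combination of
  powers minus that of its image under \<open>T_pow k\<close>.\<close>

lemma pd_inner_pow_diff:
  assumes "finite F"
  shows "pd_kernel F (\<lambda>f g. inner_sqb (pow_sqb f k) (pow_sqb g k)
    - inner_sqb (pow_sqb (T f) k) (pow_sqb (T g) k))"
proof -
  have "kernel_form F (\<lambda>f g. inner_sqb (pow_sqb f k) (pow_sqb g k)
      - inner_sqb (pow_sqb (T f) k) (pow_sqb (T g) k)) a
    = complex_of_real ((norm2_sqb (\<Sum>f\<in>F. a f *\<^sub>C pow_sqb f k))\<^sup>2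
      - (norm2_sqb (T_pow k (\<Sum>f\<in>F. a f *\<^sub>C pow_sqb f k)))\<^sup>2)" for a
    by (simp add: kernel_form_diff kernel_form_inner_sqb pow_sqb_T T_pow_sum[OF assms] T_pow_scale)
  then show ?thesis
    unfolding pd_kernel_def using norm2_T_pow_le
    by (simp flip: inner_sqb_commute)
qed

lemma pd_level_kernel: "pd_kernel F (level_kernel n)"
  unfolding pd_kernel_def level_kernel_def kernel_form_cinner
  by (simp add: cinner_self flip: cinner_commute)

text \<open>With \<open>q\<close> and \<open>p\<close> the kernels in the recursion and \<open>q\<^sub>T\<close>, \<open>p\<^sub>T\<close> their images under \<open>T\<close>, use
  \<open>q p - q\<^sub>T p\<^sub>T = (q - q\<^sub>T) p + q\<^sub>T (p - p\<^sub>T)\<close> and the Schur product theorem.\<close>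

lemma pd_level_kernel_diff:
  assumes "finite F"
  shows "pd_kernel F (\<lambda>f g. level_kernel n f g - level_kernel n (T f) (T g))"
proof (induction n rule: less_induct)
  case (less n)
  show ?case
  proof (cases n)
    case 0
    then show ?thesis
      by (simp add: level_kernel_0 pd_kernel_def kernel_form_def)
  next
    case (Suc m)
    let ?q = "\<lambda>k f g. inner_sqb (pow_sqb f k) (pow_sqb g k)"
    have "pd_kernel F (\<lambda>f g. \<Sum>k\<le>m. complex_of_real (2 * c * 4 ^ k / real (Suc m))
        * ((?q k f g - ?q k (T f) (T g)) * level_kernel (m - k) f g
          + ?q k (T f) (T g) * (level_kernel (m - k) f g - level_kernel (m - k) (T f) (T g))))"
      using c_pos Suc
      by (intro pd_kernel_sum pd_kernel_scale pd_kernel_add pd_kernel_mult assms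
          pd_inner_pow_diff pd_level_kernel pd_inner_pow less) auto
    then show ?thesis
      unfolding Suc level_kernel_Suc
      by (rule pd_kernel_cong) (simp add: algebra_simps flip: sum_subtractf)
  qed
qed

lemma norm_level_le:
  assumes "finite F"
  shows "norm (\<Sum>f\<in>F. a f *\<^sub>C \<psi> (T f) n) \<le> norm (\<Sum>f\<in>F. a f *\<^sub>C \<psi> f n)"
proof -
  have "0 \<le> Re (kernel_form F (\<lambda>f g. level_kernel n f g - level_kernel n (T f) (T g)) a)"
    by (rule pd_kernel_form[OF pd_level_kernel_diff[OF assms]])
  then have "(norm (\<Sum>f\<in>F. a f *\<^sub>C \<psi> (T f) n))\<^sup>2 \<le> (norm (\<Sum>f\<in>F. a f *\<^sub>C \<psi> f n))\<^sup>2"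
    by (simp add: kernel_form_diff level_kernel_def kernel_form_cinner cinner_self)
  then show ?thesis by (simp add: power2_le_iff_abs_le)
qed

section \<open>From the levels to exponential vectors and \<open>Gamma2\<close>\<close>

lemma T_norm_inf_less: "norm_inf_sqb f < 1/2 \<Longrightarrow> norm_inf_sqb (T f) < 1/2"
  using T_norm_inf[of f] by linarith

lemma qexp_sums: "norm_inf_sqb f < 1/2 \<Longrightarrow> \<psi> f sums qexp \<pi> \<Phi> f"
  using qexp_exists[OF c_pos] unfolding qexp_exists_def qexp_def by (rule summable_sums)

text \<open>Orthogonality of the levels makes the squared norm of a partial sum the sum of the
  squared level norms, so the level bounds add up and pass to the limit.\<close>

lemma norm_qexp_sum_le:
  assumes F: "finite F" "\<And>f. f \<in> F \<Longrightarrow> norm_inf_sqb f < 1/2"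
  shows "norm (\<Sum>f\<in>F. a f *\<^sub>C qexp \<pi> \<Phi> (T f)) \<le> norm (\<Sum>f\<in>F. a f *\<^sub>C qexp \<pi> \<Phi> f)"
proof -
  let ?w = "\<lambda>S n. \<Sum>f\<in>F. a f *\<^sub>C \<psi> (S f) n"
  have orth: "cinner (?w S m) (?w S n) = 0" if "m \<noteq> n" for S m n
    using psi_orthogonal[OF that]
    by (simp add: cinner_sum_left cinner_sum_right cinner_scaleC_left cinner_scaleC_right)
  have "?w (\<lambda>f. f) sums (\<Sum>f\<in>F. a f *\<^sub>C qexp \<pi> \<Phi> f)"
    "?w T sums (\<Sum>f\<in>F. a f *\<^sub>C qexp \<pi> \<Phi> (T f))"
    by (intro sums_sum sums_scaleC qexp_sums T_norm_inf_less F(2); assumption)+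
  then have "(\<lambda>N. norm (\<Sum>n<N. ?w (\<lambda>f. f) n)) \<longlonglongrightarrow> norm (\<Sum>f\<in>F. a f *\<^sub>C qexp \<pi> \<Phi> f)"
    "(\<lambda>N. norm (\<Sum>n<N. ?w T n)) \<longlonglongrightarrow> norm (\<Sum>f\<in>F. a f *\<^sub>C qexp \<pi> \<Phi> (T f))"
    unfolding sums_def by (simp_all only: tendsto_norm)
  moreover have sq: "(norm (\<Sum>n<N. ?w S n))\<^sup>2 = (\<Sum>n<N. (norm (?w S n))\<^sup>2)" for S N
    by (rule norm_sq_sum_orthogonal) (rule orth)
  have "norm (\<Sum>n<N. ?w T n) \<le> norm (\<Sum>n<N. ?w (\<lambda>f. f) n)" for N
  proof -
    have "(norm (\<Sum>n<N. ?w T n))\<^sup>2 \<le> (norm (\<Sum>n<N. ?w (\<lambda>f. f) n))\<^sup>2"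
      unfolding sq
      by (intro sum_mono power_mono norm_level_le F norm_ge_zero)
    then show ?thesis by (rule power2_le_imp_le) (rule norm_ge_zero)
  qed
  ultimately show ?thesis by (intro LIMSEQ_le) blast+
qed

lemma contractive_Gamma2: "contractive_relation (Gamma2 \<pi> \<Phi> T)"
proof
  show "(0, 0) \<in> Gamma2 \<pi> \<Phi> T"
    using Gamma2_I[of "{}" "\<lambda>_. 0" \<pi> \<Phi> T] by simp
next
  fix x y x' y' assume 1: "(x, y) \<in> Gamma2 \<pi> \<Phi> T" and 2: "(x', y') \<in> Gamma2 \<pi> \<Phi> T"
  from 1 obtain F a where F: "finite F" "\<And>f. f \<in> F \<Longrightarrow> norm_inf_sqb f < 1/2"
    and xy: "x = (\<Sum>f\<in>F. a f *\<^sub>C qexp \<pi> \<Phi> f)" "y = (\<Sum>f\<in>F. a f *\<^sub>C qexp \<pi> \<Phi> (T f))"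
    by (rule Gamma2_E) blast
  from 2 obtain F' a' where F': "finite F'" "\<And>f. f \<in> F' \<Longrightarrow> norm_inf_sqb f < 1/2"
    and xy': "x' = (\<Sum>f\<in>F'. a' f *\<^sub>C qexp \<pi> \<Phi> f)" "y' = (\<Sum>f\<in>F'. a' f *\<^sub>C qexp \<pi> \<Phi> (T f))"
    by (rule Gamma2_E) blast
  \<comment> \<open>Both coefficient families are extended by 0 to the union, since \<open>F\<close>
    and \<open>F'\<close> may overlap.\<close>
  define b where "b f = (if f \<in> F then a f else 0) + (if f \<in> F' then a' f else 0)" for f
  have eq: "(\<Sum>f\<in>F. a f *\<^sub>C v f) + (\<Sum>f\<in>F'. a' f *\<^sub>C v f) = (\<Sum>f\<in>F \<union> F'. b f *\<^sub>C v f)"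
    for v :: "'d sqb \<Rightarrow> 'h"
  proof -
    have "(\<Sum>f\<in>F. a f *\<^sub>C v f) = (\<Sum>f\<in>F \<union> F'. (if f \<in> F then a f else 0) *\<^sub>C v f)"
      using F(1) F'(1) by (intro sum.mono_neutral_cong_left) auto
    moreover have "(\<Sum>f\<in>F'. a' f *\<^sub>C v f) = (\<Sum>f\<in>F \<union> F'. (if f \<in> F' then a' f else 0) *\<^sub>C v f)"
      using F(1) F'(1) by (intro sum.mono_neutral_cong_left) auto
    ultimately show ?thesis
      by (simp add: b_def scaleC_add_left sum.distrib)
  qed
  show "(x + x', y + y') \<in> Gamma2 \<pi> \<Phi> T"
    unfolding xy xy' eq by (rule Gamma2_I) (use F F' in blast)+
next
  fix x y s assume "(x, y) \<in> Gamma2 \<pi> \<Phi> T"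
  then obtain F a where F: "finite F" "\<And>f. f \<in> F \<Longrightarrow> norm_inf_sqb f < 1/2"
    and xy: "x = (\<Sum>f\<in>F. a f *\<^sub>C qexp \<pi> \<Phi> f)" "y = (\<Sum>f\<in>F. a f *\<^sub>C qexp \<pi> \<Phi> (T f))"
    by (rule Gamma2_E) blast
  show "(s *\<^sub>C x, s *\<^sub>C y) \<in> Gamma2 \<pi> \<Phi> T"
    unfolding xy cvec.scale_sum_right scaleC_scaleC by (rule Gamma2_I[OF F])
next
  fix x y assume "(x, y) \<in> Gamma2 \<pi> \<Phi> T"
  then show "norm y \<le> norm x"
    by (rule Gamma2_E) (use norm_qexp_sum_le in blast)
qed

lemma Gamma2_contraction: "Gamma2_contraction \<pi> \<Phi> T"
proof -
  interpret R: contractive_relation "Gamma2 \<pi> \<Phi> T" by (rule contractive_Gamma2)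
  show ?thesis
    unfolding Gamma2_contraction_def Gamma2_well_defined_def
    using R.single_valued R.linear_contraction_extension qexp_exists[OF c_pos] T_norm_inf_less
    by simp
qed

end

theorem proposition2:
  fixes c :: real
    and \<omega> :: "'d::finite free_alg \<Rightarrow> complex"
    and \<pi> :: "'d free_alg \<Rightarrow> 'h::complex_hilbert \<Rightarrow> 'h"
    and \<Phi> :: 'h
    and \<phi> :: "'d sqb"
    and T\<^sub>1 T :: "'d sqb \<Rightarrow> 'd sqb"
  assumes "c > 0"
    and "fock_state c \<omega>"
    and "gns_triple c \<omega> \<pi> \<Phi>"
    and "norm_inf_sqb \<phi> \<le> 1"
    and "clinear T\<^sub>1"
    and "\<And>f g. T\<^sub>1 (f * g) = T\<^sub>1 f * T\<^sub>1 g"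
    and "\<And>f. T f = \<phi> * T\<^sub>1 f"
    and "\<And>f. norm2_sqb (T f) \<le> norm2_sqb f"
    and "\<And>f. norm_inf_sqb (T f) \<le> norm_inf_sqb f"
  shows "Gamma2_contraction \<pi> \<Phi> T"
proof -
  interpret fock_state c \<omega> by fact
  interpret gns_triple c \<omega> \<pi> \<Phi> by fact
  interpret second_quantization c \<omega> \<pi> \<Phi> \<phi> T\<^sub>1 T
    by (intro second_quantization.intro fock_gns.intro second_quantization_axioms.intro) (fact assms)+
  show ?thesis by (rule Gamma2_contraction)
qed

end
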